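(* Let $1\le d\le n/2$ and $\varepsilon\in(0,1]$. Any algorithm that, given i.i.d. samples from an arbitrary degree-$d$ Bayes net $P$ over $\{0,1\}^n$, distinguishes with probability at least $2/3$ between ($P$ is a product distribution) and ($d_{\mathrm{TV}}(P,Q)\ge\varepsilon$ for every product distribution $Q$) requires $\Omega(2^{d/2}\sqrt n/\varepsilon^2)$ samples. This holds even if the DAG structure of the degree-$d$ Bayes net is known to the algorithm.
   Context: A degree-$d$ Bayes net on $\{0,1\}^n$ is a distribution factorizing as $\prod_iP(x_i\mid x_{\Pi_i})$ along a DAG on $[n]$ where each node has at most $d$ parents $\Pi_i$. A product distribution has mutually independent coordinates. $d_{\mathrm{TV}}$ is total variation distance; $\Omega$ hides an absolute constant.
   Formalization: At ε=1 the claim fails: no distribution on {0,1}^n is at distance 1 from the uniform one, so zero samples suffice. The formal theorem is stated for 0<ε≤ε₀, where ε₀>0 is an absolute constant independent of n and d, instead of all ε in (0,1]. *)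

theory Defs
  imports "HOL-Probability.Probability"
begin

text \<open>
  A point of \<open>{0,1}\<^sup>n\<close> is a function \<open>nat \<Rightarrow> bool\<close> that is
  \<open>False\<close> outside \<open>{..<n}\<close>; this matches the convention of \<^const>\<open>Pi_pmf\<close>.
\<close>

definition cube :: "nat \<Rightarrow> (nat \<Rightarrow> bool) set" where
  "cube n = PiE_dflt {..<n} False (\<lambda>_. UNIV)"

definition product_distribution :: "nat \<Rightarrow> (nat \<Rightarrow> bool) pmf \<Rightarrow> bool" where
  "product_distribution n Q \<longleftrightarrow>
     set_pmf Q \<subseteq> cube n \<and>
     prob_space.indep_vars (measure_pmf Q) (\<lambda>_. count_space UNIV) (\<lambda>i x. x i) {..<n}"

definition tv_dist :: "'a pmf \<Rightarrow> 'a pmf \<Rightarrow> real" where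
  "tv_dist P Q = (SUP A. \<bar>measure_pmf.prob P A - measure_pmf.prob Q A\<bar>)"

text \<open>A pair \<open>(j, i)\<close> is an edge from the parent \<open>j\<close> to the child \<open>i\<close>.\<close>

definition parents :: "(nat \<times> nat) set \<Rightarrow> nat \<Rightarrow> nat set" where
  "parents E i = {j. (j, i) \<in> E}"

definition degree_dag :: "nat \<Rightarrow> nat \<Rightarrow> (nat \<times> nat) set \<Rightarrow> bool" where
  "degree_dag n d E \<longleftrightarrow>
     E \<subseteq> {..<n} \<times> {..<n} \<and> acyclic E \<and> (\<forall>i<n. card (parents E i) \<le> d)"

text \<open>
  A conditional probability given a null event is \<open>0\<close> by the library's convention. This is
  harmless below: if some \<open>x\<close> gives its parent values at a node probability zero, then \<open>x\<close>
  itself has probability zero, so both sides of the factorization vanish.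
\<close>

definition bayes_net_on :: "nat \<Rightarrow> (nat \<times> nat) set \<Rightarrow> (nat \<Rightarrow> bool) pmf \<Rightarrow> bool" where
  "bayes_net_on n E P \<longleftrightarrow>
     set_pmf P \<subseteq> cube n \<and>
     (\<forall>x\<in>cube n. pmf P x = (\<Prod>i<n. \<P>(y in P. y i = x i \<bar> \<forall>j\<in>parents E i. y j = x j)))"

definition degree_bayes_net :: "nat \<Rightarrow> nat \<Rightarrow> (nat \<Rightarrow> bool) pmf \<Rightarrow> bool" where
  "degree_bayes_net n d P \<longleftrightarrow> (\<exists>E. degree_dag n d E \<and> bayes_net_on n E P)"

text \<open>
  A (randomized) algorithm using \<open>m\<close> samples is a map \<open>T\<close> from sample lists to distributions
  over answers, where \<open>True\<close> stands for ``product''; \<open>C\<close> is the class of distributions that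
  the algorithm has to handle.
\<close>

definition independence_tester ::
  "nat \<Rightarrow> real \<Rightarrow> ((nat \<Rightarrow> bool) pmf \<Rightarrow> bool) \<Rightarrow> nat \<Rightarrow> ((nat \<Rightarrow> bool) list \<Rightarrow> bool pmf) \<Rightarrow> bool"
where
  "independence_tester n \<epsilon> C m T \<longleftrightarrow>
     (\<forall>P. C P \<longrightarrow>
        (product_distribution n P \<longrightarrow>
           pmf (bind_pmf (replicate_pmf m P) T) True \<ge> 2/3) \<and>
        ((\<forall>Q. product_distribution n Q \<longrightarrow> tv_dist P Q \<ge> \<epsilon>) \<longrightarrow>
           pmf (bind_pmf (replicate_pmf m P) T) False \<ge> 2/3))"

end

theory Submission
  imports Defs
begin

text \<open>
  Let \<open>d - 1\<close> uniform selector bits be common parents of the second member of each of at least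
  \<open>n / 4\<close> disjoint pairs. For every setting of the selectors and every pair choose a random sign, and correlate the two
  members of the pair with this sign and strength \<open>\<delta>\<close> of order \<open>\<epsilon> / sqrt n\<close>. Each such
  distribution is a Bayes net on the same graph, and so is the uniform one. It is far from
  uniform because the signed sum over the pairs detects it, and hence far from every product
  distribution, as the selectors with the first members and the second members are marginally uniform.
  A tester must tell the uniform distribution from the random mixture of
  these nets. The second moment of the mixture's likelihood ratio is the average over two sign patterns of
  \<open>\<langle>L, L'\<rangle> ^ m\<close>, which is at most the average of \<open>exp (m * (\<langle>L, L'\<rangle> - 1))\<close>. This decouples over the
  \<open>2 ^ (d - 1)\<close> selector settings and is subgaussian: it is \<open>exp (O(m\<^sup>2 * \<epsilon> ^ 4 / (2 ^ d * n)))\<close>.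
\<close>

subsection \<open>Averages over Boolean cubes\<close>

text \<open>Generic in the index type: the sign patterns, indexed by a selector set and a pair
  number, form such a cube just as the sample points do.\<close>

definition bool_cube :: "'a set \<Rightarrow> ('a \<Rightarrow> bool) set" where
  "bool_cube A = PiE_dflt A False (\<lambda>_. UNIV)"

definition flip :: "'a \<Rightarrow> ('a \<Rightarrow> bool) \<Rightarrow> 'a \<Rightarrow> bool" where
  "flip i x = x(i := \<not> x i)"

definition avg :: "'a set \<Rightarrow> ('a \<Rightarrow> real) \<Rightarrow> real" where
  "avg A f = (\<Sum>x\<in>A. f x) / card A"

definition sign :: "bool \<Rightarrow> real" where
  "sign b = (if b then 1 else -1)"

lemma cube_eq_bool_cube: "cube n = bool_cube {..<n}"
  by (simp add: cube_def bool_cube_def)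

lemma finite_bool_cube [simp]: "finite A \<Longrightarrow> finite (bool_cube A)"
  unfolding bool_cube_def by (rule finite_PiE_dflt) auto

lemma bool_cube_nonempty [simp]: "bool_cube A \<noteq> {}"
  by (auto simp: bool_cube_def)

lemma card_bool_cube: "finite A \<Longrightarrow> card (bool_cube A) = 2 ^ card A"
  unfolding bool_cube_def by (subst card_PiE_dflt) auto

lemma flip_flip [simp]: "flip i (flip i x) = x"
  by (simp add: flip_def)

lemma flip_same [simp]: "flip i x i = (\<not> x i)"
  by (simp add: flip_def)

lemma flip_other [simp]: "j \<noteq> i \<Longrightarrow> flip i x j = x j"
  by (simp add: flip_def)

lemma flip_in_bool_cube: "i \<in> A \<Longrightarrow> x \<in> bool_cube A \<Longrightarrow> flip i x \<in> bool_cube A"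
  by (auto simp: bool_cube_def PiE_dflt_def flip_def)

lemma sign_not [simp]: "sign (\<not> b) = - sign b"
  by (simp add: sign_def)

lemma sign_sq [simp]: "sign b * sign b = 1"
  by (simp add: sign_def)

lemma avg_flip: "i \<in> A \<Longrightarrow> avg (bool_cube A) (\<lambda>x. f (flip i x)) = avg (bool_cube A) f"
  unfolding avg_def
  by (rule arg_cong2[where f="(/)"], rule sum.reindex_bij_witness[of _ "flip i" "flip i"])
     (auto intro: flip_in_bool_cube)

lemma avg_add: "avg A (\<lambda>x. f x + g x) = avg A f + avg A g"
  by (simp add: avg_def sum.distrib add_divide_distrib)

lemma avg_diff: "avg A (\<lambda>x. f x - g x) = avg A f - avg A g"
  by (simp add: avg_def sum_subtractf diff_divide_distrib)

lemma avg_cmult: "avg A (\<lambda>x. c * f x) = c * avg A f"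
  by (simp add: avg_def sum_distrib_left)

lemma avg_multc: "avg A (\<lambda>x. f x * c) = avg A f * c"
  by (simp add: avg_def sum_distrib_right)

lemma avg_sum: "avg A (\<lambda>x. \<Sum>j\<in>J. f j x) = (\<Sum>j\<in>J. avg A (f j))"
  unfolding avg_def by (subst sum.swap) (simp add: sum_divide_distrib)

lemma avg_swap: "avg A (\<lambda>x. avg B (\<lambda>y. f x y)) = avg B (\<lambda>y. avg A (\<lambda>x. f x y))"
  unfolding avg_def by (simp add: sum_divide_distrib[symmetric]) (subst sum.swap, simp)

lemma avg_const: "finite A \<Longrightarrow> A \<noteq> {} \<Longrightarrow> avg A (\<lambda>_. c) = c"
  by (simp add: avg_def)

lemma avg_mono: "(\<And>x. x \<in> A \<Longrightarrow> f x \<le> g x) \<Longrightarrow> avg A f \<le> avg A g"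
  unfolding avg_def by (intro divide_right_mono sum_mono) auto

lemma avg_cong: "(\<And>x. x \<in> A \<Longrightarrow> f x = g x) \<Longrightarrow> avg A f = avg A g"
  unfolding avg_def by (simp cong: sum.cong)

text \<open>\<open>flip i\<close> permutes the cube, so the average equals its own negative.
  Independence of uniform bits is mostly used in this form below.\<close>

lemma avg_odd:
  assumes "i \<in> A" "\<And>x. f (flip i x) = - f x"
  shows "avg (bool_cube A) f = 0"
  using avg_flip[where f=f, OF assms(1)] avg_cmult[of "bool_cube A" "-1" f] by (simp add: assms(2))

lemma avg_drop_odd:
  assumes "i \<in> A" "\<And>x. f (flip i x) = - f x"
  shows "avg (bool_cube A) (\<lambda>x. g x + f x) = avg (bool_cube A) g"
  by (simp add: avg_add avg_odd[of i A f] assms)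

text \<open>Expand one factor at a time: everything but \<open>v l\<close> ignores the bit
  \<open>b l\<close>, so the term with \<open>v l\<close> is odd and vanishes.\<close>

lemma avg_prod_drop_odd:
  assumes "finite J" and b: "\<And>j. j \<in> J \<Longrightarrow> b j \<in> A"
    and G: "\<And>j x. j \<in> J \<Longrightarrow> G (flip (b j) x) = G x"
    and u: "\<And>j k x. j \<in> J \<Longrightarrow> k \<in> J \<Longrightarrow> u k (flip (b j) x) = u k x"
    and v: "\<And>j x. j \<in> J \<Longrightarrow> v j (flip (b j) x) = - v j x"
    and v': "\<And>j k x. j \<in> J \<Longrightarrow> k \<in> J \<Longrightarrow> j \<noteq> k \<Longrightarrow> v k (flip (b j) x) = v k x"
  shows "avg (bool_cube A) (\<lambda>x. G x * (\<Prod>j\<in>J. u j x + v j x)) =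
         avg (bool_cube A) (\<lambda>x. G x * (\<Prod>j\<in>J. u j x))"
  using assms
proof (induction J arbitrary: G rule: finite_induct)
  case empty
  show ?case by simp
next
  case (insert l J)
  have l: "j \<noteq> l" "l \<noteq> j" if "j \<in> J" for j using that insert.hyps by auto
  have e: "(\<Prod>j\<in>J. u j x + v j (flip (b l) x)) = (\<Prod>j\<in>J. u j x + v j x)" for x
    using insert.prems insert.hyps by (intro prod.cong refl arg_cong2[where f="(+)"]) (auto simp: l)
  have "avg (bool_cube A) (\<lambda>x. G x * (\<Prod>j\<in>insert l J. u j x + v j x)) =
        avg (bool_cube A) (\<lambda>x. G x * u l x * (\<Prod>j\<in>J. u j x + v j x)
                               + G x * v l x * (\<Prod>j\<in>J. u j x + v j x))"
    using insert.hyps by (simp add: algebra_simps)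
  also have "\<dots> = avg (bool_cube A) (\<lambda>x. G x * u l x * (\<Prod>j\<in>J. u j x + v j x))"
    by (rule avg_drop_odd[of "b l"]) (use insert.prems in \<open>auto simp: e\<close>)
  \<comment> \<open>The surviving \<open>u l x\<close> is absorbed into the weight, which is why
    \<open>G\<close> is arbitrary in the induction.\<close>
  also have "\<dots> = avg (bool_cube A) (\<lambda>x. G x * u l x * (\<Prod>j\<in>J. u j x))"
    by (rule insert.IH) (use insert.prems l in auto)
  also have "\<dots> = avg (bool_cube A) (\<lambda>x. G x * (\<Prod>j\<in>insert l J. u j x))"
    using insert.hyps by (simp add: algebra_simps)
  finally show ?case .
qed

text \<open>Odd powers of the newly added sign average to zero and even ones are 1. The second
  moment is carried along because it enters the recursion for the fourth.\<close>

lemma avg_sum_signs_sq: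
  assumes "finite J" and b: "\<And>j. j \<in> J \<Longrightarrow> b j \<in> A" and "finite A"
    and sq: "\<And>j x. j \<in> J \<Longrightarrow> r j x * r j x = 1"
    and r: "\<And>j x. j \<in> J \<Longrightarrow> r j (flip (b j) x) = - r j x"
    and r': "\<And>j k x. j \<in> J \<Longrightarrow> k \<in> J \<Longrightarrow> j \<noteq> k \<Longrightarrow> r k (flip (b j) x) = r k x"
  shows "avg (bool_cube A) (\<lambda>x. (\<Sum>j\<in>J. r j x)^2) = card J \<and>
         avg (bool_cube A) (\<lambda>x. (\<Sum>j\<in>J. r j x)^4) \<le> 3 * card J ^ 2"
  using assms
proof (induction J rule: finite_induct)
  case empty
  show ?case by (simp add: avg_def)
next
  case (insert l J)
  have l: "j \<noteq> l" "l \<noteq> j" if "j \<in> J" for j using that insert.hyps by auto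
  define W where "W x = (\<Sum>j\<in>J. r j x)" for x
  have sq: "r l x ^ 2 = 1" for x using insert.prems by (simp add: power2_eq_square)
  have p3: "r l x ^ 3 = r l x" for x using sq[of x] by (simp add: power3_eq_cube power2_eq_square)
  have p4: "r l x ^ 4 = 1" for x 
    using sq[of x] by (metis mult_numeral_1_right numeral_Bit0 numeral_mult power2_eq_square power_add semiring_norm(12) power_one)
  have W: "W (flip (b l) x) = W x" for x
    unfolding W_def using insert.prems insert.hyps by (intro sum.cong refl) (auto simp: l)
  have rl: "r l (flip (b l) x) = - r l x" "b l \<in> A" for x using insert.prems by auto
  have IH: "avg (bool_cube A) (\<lambda>x. W x ^ 2) = card J \<and> avg (bool_cube A) (\<lambda>x. W x ^ 4) \<le> 3 * card J ^ 2"
    unfolding W_def by (rule insert.IH) (use insert.prems in auto)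
  have "avg (bool_cube A) (\<lambda>x. (\<Sum>j\<in>insert l J. r j x)^2) =
        avg (bool_cube A) (\<lambda>x. (W x ^ 2 + 1) + 2 * W x * r l x)"
    using insert.hyps sq by (simp add: W_def power2_sum add_ac mult_ac)
  also have "\<dots> = avg (bool_cube A) (\<lambda>x. W x ^ 2 + 1)"
    by (rule avg_drop_odd[of "b l"]) (auto simp: W rl)
  finally have e2: "avg (bool_cube A) (\<lambda>x. (\<Sum>j\<in>insert l J. r j x)^2) = card J + 1"
    using \<open>finite A\<close> by (simp add: avg_add avg_const IH)
  have q: "(r l x + W x)^4 = (W x ^ 4 + 6 * W x ^ 2 + 1) + (4 * W x ^ 3 + 4 * W x) * r l x" for x
  proof -
    have "(r l x + W x)^4 = W x ^ 4 + 4 * W x ^ 3 * r l x + 6 * W x ^ 2 * r l x ^ 2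
      + 4 * W x * r l x ^ 3 + r l x ^ 4" by algebra
    thus ?thesis by (simp add: sq p3 p4 algebra_simps)
  qed
  have "avg (bool_cube A) (\<lambda>x. (\<Sum>j\<in>insert l J. r j x)^4) =
        avg (bool_cube A) (\<lambda>x. (W x ^ 4 + 6 * W x ^ 2 + 1) + (4 * W x ^ 3 + 4 * W x) * r l x)"
    using insert.hyps by (simp add: W_def[symmetric] q)
  also have "\<dots> = avg (bool_cube A) (\<lambda>x. W x ^ 4 + 6 * W x ^ 2 + 1)"
    by (rule avg_drop_odd[of "b l"]) (auto simp: W rl)
  also have "\<dots> \<le> 3 * card J ^ 2 + 6 * card J + 1"
    using \<open>finite A\<close> IH by (simp add: avg_add avg_const avg_cmult)
  also have "\<dots> \<le> 3 * (card J + 1) ^ 2" by (simp add: power2_eq_square algebra_simps)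
  finally have e4: "avg (bool_cube A) (\<lambda>x. (\<Sum>j\<in>insert l J. r j x)^4) \<le> 3 * (card J + 1) ^ 2" .
  show ?case using e2 e4 insert.hyps by (simp add: add.commute)
qed

text \<open>The left side is the moment generating function of a fair sign, so this is the symmetric
  two-point case of Hoeffding's lemma.\<close>

lemma cosh_le_exp_half_square: "(exp (x::real) + exp (- x)) / 2 \<le> exp (x^2 / 2)"
proof -
  define y where "y = \<bar>x\<bar>"
  have "- (2 * y) * (1/2) + ln (1 + (1/2) * (exp (2 * y) - 1)) \<le> (2 * y)^2 / 8"
    by (rule Hoeffdings_lemma_aux) (auto simp: y_def)
  moreover have "1 + (1/2) * (exp (2 * y) - 1) = (1 + exp (2 * y)) / 2"
    by (simp add: diff_divide_distrib add_divide_distrib)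
  ultimately have "- (2 * y) * (1/2) + ln ((1 + exp (2 * y)) / 2) \<le> (2 * y)^2 / 8" by (simp only:)
  moreover have "(2 * y)^2 / 8 = y^2 / 2" by (simp add: power_mult_distrib)
  ultimately have "ln ((1 + exp (2 * y)) / 2) \<le> y^2 / 2 + y" by linarith
  moreover have "0 < (1 + exp (2 * y)) / 2" by (simp add: add_pos_pos)
  ultimately have "(1 + exp (2 * y)) / 2 \<le> exp (y^2 / 2 + y)"
    by (metis exp_le_cancel_iff exp_ln)
  hence "(1 + exp y * exp y) / 2 \<le> exp (y^2 / 2) * exp y"
    by (simp only: exp_add mult_2)
  hence "(1 + exp y * exp y) / 2 * exp (- y) \<le> exp (y^2 / 2) * exp y * exp (- y)"
    by (rule mult_right_mono) simp
  moreover have "(1 + exp y * exp y) / 2 * exp (- y) = (exp y + exp (- y)) / 2"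
    by (simp add: algebra_simps add_divide_distrib exp_minus_inverse)
  ultimately have "(exp y + exp (- y)) / 2 \<le> exp (y^2 / 2)"
    by (simp add: mult.assoc exp_minus_inverse)
  thus ?thesis unfolding y_def by (cases "x \<ge> 0") (auto simp: add.commute)
qed

text \<open>Averaging a point with its flip turns \<open>exp (f x)\<close> into
  \<open>cosh (f x)\<close> and leaves \<open>a\<close> alone.\<close>

lemma avg_exp_odd_le:
  assumes "i \<in> A" and a: "\<And>x. a (flip i x) = a x" and f: "\<And>x. f (flip i x) = - f x"
    and c: "\<And>x. \<bar>f x\<bar> \<le> c"
  shows "avg (bool_cube A) (\<lambda>x. exp (a x + f x)) \<le> avg (bool_cube A) (\<lambda>x. exp (a x)) * exp (c^2 / 2)"
proof -
  have "avg (bool_cube A) (\<lambda>x. exp (a x + f x)) = 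
     (avg (bool_cube A) (\<lambda>x. exp (a x + f x)) + avg (bool_cube A) (\<lambda>x. exp (a (flip i x) + f (flip i x)))) * (1/2)"
    using avg_flip[OF assms(1), of "\<lambda>x. exp (a x + f x)"] by simp
  also have "\<dots> = avg (bool_cube A) (\<lambda>x. (exp (a x) * ((exp (f x) + exp (- f x)) / 2)))"
    by (subst avg_add[symmetric], subst avg_multc[symmetric])
      (simp add: a f exp_diff exp_add field_simps exp_minus)
  also have "\<dots> \<le> avg (bool_cube A) (\<lambda>x. exp (a x) * exp (c^2 / 2))"
  proof (intro avg_mono mult_left_mono)
    fix x
    have "(exp (f x) + exp (- f x)) / 2 \<le> exp ((f x)^2 / 2)" by (rule cosh_le_exp_half_square)
    also have "\<dots> \<le> exp (c^2 / 2)" using power_mono[OF c[of x], of 2] by simp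
    finally show "(exp (f x) + exp (- f x)) / 2 \<le> exp (c^2 / 2)" .
  qed auto
  finally show ?thesis by (simp add: avg_multc)
qed

subsection \<open>Total variation distance\<close>

lemma tv_dist_bdd: "bdd_above (range (\<lambda>A. \<bar>measure_pmf.prob P A - measure_pmf.prob Q A\<bar>))"
proof (rule bdd_aboveI2)
  fix A
  show "\<bar>measure_pmf.prob P A - measure_pmf.prob Q A\<bar> \<le> 1"
    using measure_pmf.prob_le_1[of P A] measure_pmf.prob_le_1[of Q A]
      measure_nonneg[of "measure_pmf P" A] measure_nonneg[of "measure_pmf Q" A] by linarith
qed

lemma abs_prob_diff_le_tv_dist: "\<bar>measure_pmf.prob P A - measure_pmf.prob Q A\<bar> \<le> tv_dist P Q"
  unfolding tv_dist_def by (rule cSUP_upper2[OF tv_dist_bdd]) auto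

lemma tv_dist_leI: "(\<And>A. \<bar>measure_pmf.prob P A - measure_pmf.prob Q A\<bar> \<le> c) \<Longrightarrow> tv_dist P Q \<le> c"
  unfolding tv_dist_def by (rule cSUP_least) auto

lemma tv_dist_commute: "tv_dist P Q = tv_dist Q P"
  by (simp add: tv_dist_def abs_minus_commute)

lemma tv_dist_triangle: "tv_dist P R \<le> tv_dist P Q + tv_dist Q R"
proof (rule tv_dist_leI)
  fix A
  show "\<bar>measure_pmf.prob P A - measure_pmf.prob R A\<bar> \<le> tv_dist P Q + tv_dist Q R"
    using abs_prob_diff_le_tv_dist[of P A Q] abs_prob_diff_le_tv_dist[of Q A R] by linarith
qed

lemma tv_dist_map_pmf: "tv_dist (map_pmf f P) (map_pmf f Q) \<le> tv_dist P Q"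
  by (rule tv_dist_leI) (simp add: abs_prob_diff_le_tv_dist)

text \<open>Condition on the shared first component: each section of \<open>A\<close> is an event
  for the second one, and averaging over \<open>R\<close> keeps the bound.\<close>

lemma tv_dist_pair_pmf_right:
  fixes P Q :: "'b pmf"
  shows "tv_dist (pair_pmf (R :: 'a pmf) P) (pair_pmf R Q) \<le> tv_dist P Q"
proof (rule tv_dist_leI)
  fix A :: "('a \<times> 'b) set"
  have e: "measure_pmf.prob (pair_pmf R S) A = measure_pmf.expectation R (\<lambda>r. measure_pmf.prob S {x. (r, x) \<in> A})"
    for S :: "'b pmf"
  proof -
    have "pair_pmf R S = bind_pmf R (\<lambda>r. map_pmf (Pair r) S)"
      by (simp add: pair_pmf_def map_pmf_def)
    hence "ennreal (measure_pmf.prob (pair_pmf R S) A) = (\<integral>\<^sup>+ r. measure_pmf.prob S {x. (r, x) \<in> A} \<partial>R)"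
      by (simp add: measure_pmf.emeasure_eq_measure[symmetric] vimage_def)
    also have "\<dots> = measure_pmf.expectation R (\<lambda>r. measure_pmf.prob S {x. (r, x) \<in> A})"
      by (intro nn_integral_eq_integral measure_pmf.integrable_const_bound[where B=1]) auto
    finally show ?thesis by (simp add: integral_nonneg_AE)
  qed
  have "measure_pmf.prob (pair_pmf R P) A - measure_pmf.prob (pair_pmf R Q) A =
    measure_pmf.expectation R (\<lambda>r. measure_pmf.prob P {x. (r, x) \<in> A} - measure_pmf.prob Q {x. (r, x) \<in> A})"
    unfolding e
    by (subst Bochner_Integration.integral_diff) (auto intro!: measure_pmf.integrable_const_bound[where B=1])
  also have "\<bar>\<dots>\<bar> \<le> measure_pmf.expectation R (\<lambda>r. tv_dist P Q)"
    by (rule order_trans[OF integral_abs_bound integral_mono])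
       (auto intro!: measure_pmf.integrable_const_bound[where B="tv_dist P Q"] simp: abs_prob_diff_le_tv_dist)
  finally show "\<bar>measure_pmf.prob (pair_pmf R P) A - measure_pmf.prob (pair_pmf R Q) A\<bar> \<le> tv_dist P Q"
    by simp
qed

lemma tv_dist_pair_pmf: "tv_dist (pair_pmf P P) (pair_pmf Q Q) \<le> 2 * tv_dist P Q"
proof -
  \<comment> \<open>One component is replaced at a time; swapping components reduces the left one to
    the right one.\<close>
  have "tv_dist (pair_pmf P P) (pair_pmf Q P) \<le> tv_dist (pair_pmf P P) (pair_pmf P Q)"
    using tv_dist_map_pmf[of "\<lambda>(x, y). (y, x)" "pair_pmf P P" "pair_pmf P Q"]
    by (simp only: pair_commute_pmf[symmetric])
  thus ?thesis
    using tv_dist_triangle[of "pair_pmf P P" "pair_pmf Q Q" "pair_pmf Q P"]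
      tv_dist_pair_pmf_right[of P P Q] tv_dist_pair_pmf_right[of Q P Q]
    by linarith
qed

subsection \<open>The second moment method for testers\<close>

text \<open>Multiplying out the power gives one product per list; this makes averages over i.i.d.
  samples factorize.\<close>

lemma sum_lists_length_prod_list:
  fixes f :: "'a \<Rightarrow> real"
  assumes "finite A"
  shows "(\<Sum>xs | set xs \<subseteq> A \<and> length xs = m. \<Prod>x\<leftarrow>xs. f x) = (\<Sum>x\<in>A. f x) ^ m"
proof (induction m)
  case 0
  have "{xs. set xs \<subseteq> A \<and> length xs = 0} = {[]}" by auto
  then show ?case by simp
next
  case (Suc m)
  have "(\<Sum>xs | set xs \<subseteq> A \<and> length xs = Suc m. \<Prod>x\<leftarrow>xs. f x) =
        (\<Sum>(x, xs)\<in>A \<times> {xs. set xs \<subseteq> A \<and> length xs = m}. f x * (\<Prod>x\<leftarrow>xs. f x))"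
    by (rule sum.reindex_bij_witness[of _ "\<lambda>(x, xs). x # xs" "\<lambda>xs. (hd xs, tl xs)"])
       (auto simp: length_Suc_conv)
  also have "\<dots> = (\<Sum>x\<in>A. f x) ^ Suc m"
    by (subst sum.cartesian_product[symmetric]) (simp add: sum_distrib_left[symmetric] sum_distrib_right[symmetric] Suc)
  finally show ?case .
qed

lemma prod_list_mult_distrib:
  "(\<Prod>x\<leftarrow>xs. f x * g x :: 'a :: comm_monoid_mult) = (\<Prod>x\<leftarrow>xs. f x) * (\<Prod>x\<leftarrow>xs. g x)"
  by (induction xs) (auto simp: ac_simps)

lemma avg_lists_length_prod_list:
  assumes "finite A"
  shows "avg {xs. set xs \<subseteq> A \<and> length xs = m} (\<lambda>xs. \<Prod>x\<leftarrow>xs. f x) = avg A f ^ m"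
  using sum_lists_length_prod_list[OF assms, of f m] assms
  by (simp add: avg_def card_lists_length_eq power_divide)

lemma pmf_replicate_pmf: "length xs = m \<Longrightarrow> pmf (replicate_pmf m P) xs = (\<Prod>x\<leftarrow>xs. pmf P x)"
proof (induction xs arbitrary: m)
  case Nil
  then show ?case by simp
next
  case (Cons x xs)
  then obtain k where m: "m = Suc k" "length xs = k" by auto
  have "replicate_pmf m P = map_pmf (\<lambda>(x, xs). x # xs) (pair_pmf P (replicate_pmf k P))"
    by (simp add: m pair_pmf_def map_bind_pmf)
  also have "pmf \<dots> (x # xs) = pmf (pair_pmf P (replicate_pmf k P)) (x, xs)"
    using pmf_map_inj'[of "\<lambda>(x, xs). x # xs" _ "(x, xs)"] by (auto simp: inj_def)
  finally show ?case using Cons.IH[OF m(2)] by (simp add: pmf_pair)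
qed

text \<open>Here \<open>f\<close> is the density relative to the uniform distribution on
  \<open>A\<close>. Its products over the samples let all distributions be compared on the one space
  of uniform sample lists.\<close>

lemma pmf_bind_replicate_density:
  assumes A: "finite A" "A \<noteq> {}" and supp: "set_pmf P \<subseteq> A" and L: "\<And>x. x \<in> A \<Longrightarrow> pmf P x = f x / card A"
  shows "pmf (bind_pmf (replicate_pmf m P) T) y =
    avg {xs. set xs \<subseteq> A \<and> length xs = m} (\<lambda>xs. pmf (T xs) y * (\<Prod>x\<leftarrow>xs. f x))"
proof -
  let ?X = "{xs. set xs \<subseteq> A \<and> length xs = m}"
  have d: "pmf (replicate_pmf m P) xs = (\<Prod>x\<leftarrow>xs. f x) / card ?X" if "xs \<in> ?X" for xs
  proof -
    have "(\<Prod>x\<leftarrow>xs. pmf P x) = (\<Prod>x\<leftarrow>xs. f x / card A)"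
      using that L by (intro arg_cong[where f=prod_list] map_cong) auto
    also have "\<dots> = (\<Prod>x\<leftarrow>xs. f x) / card A ^ length xs"
      by (induction xs) auto
    finally show ?thesis
      using that A by (simp add: pmf_replicate_pmf card_lists_length_eq)
  qed
  have "pmf (bind_pmf (replicate_pmf m P) T) y = (\<Sum>xs\<in>?X. pmf (T xs) y * pmf (replicate_pmf m P) xs)"
    unfolding pmf_bind
    by (rule integral_measure_pmf_real) (use A supp in \<open>auto simp: finite_lists_length_eq set_replicate_pmf lists_eq_set\<close>)
  also have "\<dots> = avg ?X (\<lambda>xs. pmf (T xs) y * (\<Prod>x\<leftarrow>xs. f x))"
    by (simp add: avg_def d sum_divide_distrib)
  finally show ?thesis .
qed

text \<open>Over uniform samples the acceptance probability \<open>g\<close> averages at least 2/3,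
  but \<open>g * R\<close> at most 1/3, with \<open>R\<close> the likelihood ratio of the mixture.
  As \<open>g\<close> lies in [0, 1], \<open>R\<close> must deviate from its mean 1, which forces a
  large second moment.\<close>

lemma mixture_second_moment_lower_bound:
  fixes L :: "'z \<Rightarrow> 'a \<Rightarrow> real"
  assumes A: "finite A" "A \<noteq> {}" and Z: "finite Z" "Z \<noteq> {}"
    and P: "\<And>z. z \<in> Z \<Longrightarrow> set_pmf (P z) \<subseteq> A" "\<And>z x. z \<in> Z \<Longrightarrow> x \<in> A \<Longrightarrow> pmf (P z) x = L z x / card A"
    and L1: "\<And>z. z \<in> Z \<Longrightarrow> avg A (L z) = 1"
    and null: "pmf (bind_pmf (replicate_pmf m (pmf_of_set A)) T) True \<ge> 2/3"
    and alt: "\<And>z. z \<in> Z \<Longrightarrow> pmf (bind_pmf (replicate_pmf m (P z)) T) False \<ge> 2/3"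
  shows "avg Z (\<lambda>z. avg Z (\<lambda>z'. avg A (\<lambda>x. L z x * L z' x) ^ m)) \<ge> 10/9"
proof -
  define X where "X = {xs. set xs \<subseteq> A \<and> length xs = m}"
  define g where "g xs = pmf (T xs) True" for xs
  define R where "R xs = avg Z (\<lambda>z. \<Prod>x\<leftarrow>xs. L z x)" for xs
  obtain a where "a \<in> A" using A by auto
  hence "replicate m a \<in> X" by (auto simp: X_def)
  moreover have "finite X" using A by (simp add: X_def finite_lists_length_eq)
  ultimately have X: "finite X" "X \<noteq> {}" by auto
  have one: "(\<Prod>x\<leftarrow>xs. 1::real) = 1" for xs :: "'a list"
    by (induction xs) auto
  have "avg X (\<lambda>xs. g xs * 1) \<ge> 2/3"
    using null pmf_bind_replicate_density[OF A, of "pmf_of_set A" "\<lambda>_. 1" m T True] A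
    by (simp add: X_def g_def one)
  moreover have "avg X (\<lambda>xs. g xs * R xs) \<le> 1/3"
  proof -
    have "avg X (\<lambda>xs. g xs * R xs) = avg Z (\<lambda>z. avg X (\<lambda>xs. g xs * (\<Prod>x\<leftarrow>xs. L z x)))"
      unfolding R_def avg_cmult[symmetric] by (rule avg_swap)
    also have "\<dots> = avg Z (\<lambda>z. pmf (bind_pmf (replicate_pmf m (P z)) T) True)"
      unfolding X_def g_def by (intro avg_cong pmf_bind_replicate_density[OF A, symmetric] P)
    also have "\<dots> \<le> avg Z (\<lambda>z. 1/3)"
      by (intro avg_mono) (use alt in \<open>simp add: pmf_False_conv_True\<close>)
    finally show ?thesis using Z by (simp add: avg_const)
  qed
  ultimately have "1/3 \<le> avg X (\<lambda>xs. g xs * (1 - R xs))"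
    by (simp add: right_diff_distrib avg_diff)
  also have "\<dots> \<le> avg X (\<lambda>xs. 1/6 + 3/2 * (R xs * R xs - 2 * R xs + 1))"
  proof (rule avg_mono)
    fix xs
    have g: "0 \<le> g xs" "g xs \<le> 1" by (simp_all add: g_def pmf_le_1)
    have "g xs * (1 - R xs) \<le> g xs * \<bar>1 - R xs\<bar>" using g by (intro mult_left_mono) simp_all
    also have "\<dots> \<le> \<bar>1 - R xs\<bar>" using g by (intro mult_left_le_one_le) simp_all
    \<comment> \<open>Replaces Cauchy-Schwarz; it is tight at deviation 1/3, the size of the gap, so
      the variance is at least 1/9.\<close>
    also have "\<dots> \<le> 1/6 + 3/2 * \<bar>1 - R xs\<bar>^2"
      using zero_le_power2[of "\<bar>1 - R xs\<bar> - 1/3"] unfolding power2_diff by (simp add: power2_eq_square)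
    also have "\<bar>1 - R xs\<bar>^2 = R xs * R xs - 2 * R xs + 1"
      unfolding power2_abs power2_diff by (simp add: power2_eq_square)
    finally show "g xs * (1 - R xs) \<le> 1/6 + 3/2 * (R xs * R xs - 2 * R xs + 1)" .
  qed
  also have "\<dots> = 1/6 + 3/2 * (avg X (\<lambda>xs. R xs * R xs) - 2 * avg X R + 1)"
    by (simp only: avg_add avg_diff avg_cmult avg_const[OF X])
  also have "avg X R = 1"
  proof -
    have "avg X R = avg Z (\<lambda>z. avg X (\<lambda>xs. \<Prod>x\<leftarrow>xs. L z x))"
      unfolding R_def by (rule avg_swap)
    also have "\<dots> = avg Z (\<lambda>z. 1)"
      unfolding X_def avg_lists_length_prod_list[OF A(1)] by (intro avg_cong) (simp add: L1)
    finally show ?thesis using Z by (simp add: avg_const)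
  qed
  \<comment> \<open>Squaring the mixture brings in an independent second pattern \<open>z'\<close>;
    for fixed patterns the average over sample lists is an \<open>m\<close>-th power.\<close>
  also have "avg X (\<lambda>xs. R xs * R xs) = avg Z (\<lambda>z. avg Z (\<lambda>z'. avg A (\<lambda>x. L z x * L z' x) ^ m))"
  proof -
    have "avg X (\<lambda>xs. R xs * R xs) = avg X (\<lambda>xs. avg Z (\<lambda>z. avg Z (\<lambda>z'. \<Prod>x\<leftarrow>xs. L z x * L z' x)))"
      unfolding R_def prod_list_mult_distrib by (simp only: avg_cmult avg_multc)
    also have "\<dots> = avg Z (\<lambda>z. avg X (\<lambda>xs. avg Z (\<lambda>z'. \<Prod>x\<leftarrow>xs. L z x * L z' x)))"
      by (rule avg_swap)
    also have "\<dots> = avg Z (\<lambda>z. avg Z (\<lambda>z'. avg X (\<lambda>xs. \<Prod>x\<leftarrow>xs. L z x * L z' x)))"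
      by (intro avg_cong avg_swap)
    finally show ?thesis unfolding X_def avg_lists_length_prod_list[OF A(1)] .
  qed
  finally have "1/3 \<le> 1/6 + 3/2 * (avg Z (\<lambda>z. avg Z (\<lambda>z'. avg A (\<lambda>x. L z x * L z' x) ^ m)) - 2 * 1 + 1)" .
  moreover have "10/9 \<le> v" if "1/3 \<le> 1/6 + 3/2 * (v - 2 * 1 + 1)" for v :: real
    using that by (simp add: field_simps)
  ultimately show ?thesis by blast
qed

text \<open>
  The factors are switched on one at a time: each one multiplies the average by at most
  \<open>cosh c \<le> exp (c\<^sup>2 / 2)\<close>, as its sign is independent of everything else.
\<close>

lemma avg_exp_sum_prod_le:
  fixes S :: "'s set" and w :: "'s \<times> 'j \<Rightarrow> ('a \<Rightarrow> bool) \<Rightarrow> real" and \<eta> t :: real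
  assumes fin: "finite S" "finite J" "finite A" and eta: "0 \<le> \<eta>" and lam: "0 \<le> t"
    and b: "\<And>k. k \<in> S \<times> J \<Longrightarrow> b k \<in> A"
    and w1: "\<And>k x. \<bar>w k x\<bar> \<le> 1"
    and odd: "\<And>k x. k \<in> S \<times> J \<Longrightarrow> w k (flip (b k) x) = - w k x"
    and even: "\<And>k k' x. k \<in> S \<times> J \<Longrightarrow> k' \<in> S \<times> J \<Longrightarrow> k \<noteq> k' \<Longrightarrow> w k' (flip (b k) x) = w k' x"
  shows "avg (bool_cube A) (\<lambda>x. exp (t * (\<Sum>s\<in>S. \<Prod>j\<in>J. 1 + \<eta> * w (s, j) x)))
    \<le> exp (t * card S + card S * card J * (t * (1 + \<eta>) ^ card J * \<eta>)^2 / 2)"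
proof -
  define f where "f K s x = (\<Prod>j\<in>J. if (s, j) \<in> K then 1 + \<eta> * w (s, j) x else 1)" for K s x
  define c where "c = t * (1 + \<eta>) ^ card J * \<eta>"
  have "avg (bool_cube A) (\<lambda>x. exp (t * (\<Sum>s\<in>S. f K s x))) \<le> exp (t * card S + card K * c^2 / 2)"
    if "K \<subseteq> S \<times> J" for K
    using finite_subset[OF that finite_cartesian_product[OF fin(1,2)]] that
  proof (induction K rule: finite_induct)
    case empty
    show ?case using fin by (simp add: f_def avg_const)
  next
    case (insert k K)
    obtain s l where k: "k = (s, l)" "s \<in> S" "l \<in> J" using insert.prems by auto
    define Fr where "Fr x = (\<Sum>u\<in>S - {s}. f K u x)" for x
    have fl: "f K u (flip (b k) x) = f K u x" for u x
      unfolding f_def by (intro prod.cong) (use insert in \<open>auto intro!: even\<close>)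
    have e1: "f (insert k K) u x = f K u x" if "u \<noteq> s" for u x
      unfolding f_def using that by (simp add: k)
    \<comment> \<open>Switching on \<open>k = (s, l)\<close> adds to the product for
      \<open>s\<close> a term that is odd under the flip at \<open>b k\<close>.\<close>
    have e2: "f (insert k K) s x = f K s x + f K s x * \<eta> * w k x" for x
    proof -
      have "f (insert k K) s x = (1 + \<eta> * w k x) * (\<Prod>j\<in>J-{l}. if (s, j) \<in> K then 1 + \<eta> * w (s, j) x else 1)"
        unfolding f_def by (subst prod.remove[OF fin(2) k(3)]) (auto simp: k intro!: prod.cong)
      moreover have "f K s x = (\<Prod>j\<in>J-{l}. if (s, j) \<in> K then 1 + \<eta> * w (s, j) x else 1)"
        unfolding f_def by (subst prod.remove[OF fin(2) k(3)]) (use insert.hyps k in auto)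
      ultimately show ?thesis by (simp add: algebra_simps)
    qed
    have e3: "t * (\<Sum>u\<in>S. f (insert k K) u x) = t * (\<Sum>u\<in>S. f K u x) + t * f K s x * \<eta> * w k x" for x
      by (simp add: sum.remove[OF fin(1) k(2)] e1 e2 algebra_simps)
    have bd: "\<bar>t * f K s x * \<eta> * w k x\<bar> \<le> c" for x
    proof -
      have "\<bar>f K s x\<bar> \<le> (\<Prod>j\<in>J. 1 + \<eta>)"
        unfolding f_def abs_prod
      proof (intro prod_mono conjI)
        fix j
        have "\<bar>\<eta> * w (s, j) x\<bar> \<le> \<eta>" using w1[of "(s, j)" x] eta by (simp add: abs_mult mult_left_le)
        thus "\<bar>if (s, j) \<in> K then 1 + \<eta> * w (s, j) x else 1\<bar> \<le> 1 + \<eta>" using eta by auto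
      qed auto
      hence "\<bar>f K s x\<bar> \<le> (1 + \<eta>) ^ card J" by simp
      hence "t * \<bar>f K s x\<bar> * \<eta> * \<bar>w k x\<bar> \<le> t * (1 + \<eta>) ^ card J * \<eta> * 1"
        using w1[of k x] eta lam by (intro mult_mono) auto
      thus ?thesis using eta lam by (simp add: abs_mult c_def)
    qed
    have "avg (bool_cube A) (\<lambda>x. exp (t * (\<Sum>u\<in>S. f (insert k K) u x)))
      \<le> avg (bool_cube A) (\<lambda>x. exp (t * (\<Sum>u\<in>S. f K u x))) * exp (c^2 / 2)"
      unfolding e3 by (rule avg_exp_odd_le[of "b k"]) (use insert.prems in \<open>auto simp: fl b odd bd\<close>)
    also have "\<dots> \<le> exp (t * card S + card K * c^2 / 2) * exp (c^2 / 2)"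
      using insert by (intro mult_right_mono) auto
    also have "\<dots> = exp (t * card S + card (insert k K) * c^2 / 2)"
      using insert.hyps by (simp add: exp_add[symmetric] field_simps)
    finally show ?case .
  qed
  note le = this[OF order_refl]
  have f: "(\<Sum>s\<in>S. f (S \<times> J) s x) = (\<Sum>s\<in>S. \<Prod>j\<in>J. 1 + \<eta> * w (s, j) x)" for x
    unfolding f_def by (intro sum.cong prod.cong) auto
  show ?thesis
    using le unfolding f c_def card_cartesian_product of_nat_mult .
qed

subsection \<open>The hard family\<close>

text \<open>
  The coordinates \<open>2 * j\<close> and \<open>2 * j + 1\<close> with \<open>j < N\<close> form the pairs, the following \<open>D\<close>
  coordinates are the selectors, and the remaining ones are isolated uniform bits. The sign \<open>z (s, j)\<close>
  is that of the correlation \<open>\<plusminus>\<delta>\<close> within pair \<open>j\<close> when \<open>s\<close> is the set of selectors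
  that are \<open>True\<close>; \<open>L z\<close> is the density relative to the uniform distribution.
\<close>

locale paired_construction =
  fixes n N D :: nat and \<delta> :: real
  assumes size: "2 * N + D \<le> n" and delta: "0 \<le> \<delta>" "\<delta> \<le> 1"
begin

definition "Sel = {2 * N..<2 * N + D}"

definition sel :: "(nat \<Rightarrow> bool) \<Rightarrow> nat set" where
  "sel x = {i \<in> Sel. x i}"

definition r :: "(nat set \<times> nat \<Rightarrow> bool) \<Rightarrow> (nat \<Rightarrow> bool) \<Rightarrow> nat \<Rightarrow> real" where
  "r z x j = sign (z (sel x, j)) * (sign (x (2 * j)) * sign (x (2 * j + 1)))"

definition L :: "(nat set \<times> nat \<Rightarrow> bool) \<Rightarrow> (nat \<Rightarrow> bool) \<Rightarrow> real" where
  "L z x = (\<Prod>j<N. 1 + \<delta> * r z x j)"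

text \<open>Flipping either member of a pair negates its sign \<open>r\<close>. Both choices occur:
  an event is handled by flipping the members that it ignores.\<close>

definition endpoint :: "(nat \<Rightarrow> nat) \<Rightarrow> bool" where
  "endpoint b \<longleftrightarrow> b = (\<lambda>j. 2 * j) \<or> b = (\<lambda>j. 2 * j + 1)"

lemma finite_cube [simp]: "finite (cube n)" and cube_nonempty [simp]: "cube n \<noteq> {}"
  by (simp_all add: cube_eq_bool_cube)

lemma card_cube: "card (cube n) = 2 ^ n"
  by (simp add: cube_eq_bool_cube card_bool_cube)

lemma endpoint_less: "endpoint b \<Longrightarrow> j < N \<Longrightarrow> b j < 2 * N"
  by (auto simp: endpoint_def)

lemma endpoint_less_n: "endpoint b \<Longrightarrow> j < N \<Longrightarrow> b j < n"
  using endpoint_less[of b j] size by linarith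

lemma sel_flip [simp]: "i < 2 * N \<Longrightarrow> sel (flip i x) = sel x"
  by (auto simp: sel_def Sel_def flip_def)

lemma r_flip_same: "endpoint b \<Longrightarrow> j < N \<Longrightarrow> r z (flip (b j) x) j = - r z x j"
  by (auto simp: r_def endpoint_def)

lemma r_flip_other: "endpoint b \<Longrightarrow> j < N \<Longrightarrow> k \<noteq> j \<Longrightarrow> r z (flip (b j) x) k = r z x k"
  unfolding r_def by (subst sel_flip, simp add: endpoint_less) (auto simp: endpoint_def flip_def; presburger)

lemma r_mult: "r z x j * r z' x j = sign (z (sel x, j)) * sign (z' (sel x, j))"
  by (simp add: r_def sign_def)

lemma r_sq: "r z x j * r z x j = 1"
  by (simp add: r_mult)

lemma abs_r: "\<bar>r z x j\<bar> = 1"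
  by (simp add: r_def sign_def)

lemma L_nonneg: "0 \<le> L z x"
  unfolding L_def
proof (intro prod_nonneg)
  fix j
  have "\<bar>\<delta> * r z x j\<bar> \<le> 1" using delta by (simp add: abs_mult abs_r)
  thus "0 \<le> 1 + \<delta> * r z x j" by linarith
qed

lemma avg_prod_drop_r:
  assumes b: "endpoint b" and J: "J \<subseteq> {..<N}"
    and G: "\<And>j x. j \<in> J \<Longrightarrow> G (flip (b j) x) = G x"
    and u: "\<And>j k x. j \<in> J \<Longrightarrow> k \<in> J \<Longrightarrow> u k (flip (b j) x) = u k x"
    and v: "\<And>j k x. j \<in> J \<Longrightarrow> k \<in> J \<Longrightarrow> v k (flip (b j) x) = v k x"
  shows "avg (cube n) (\<lambda>x. G x * (\<Prod>j\<in>J. u j x + v j x * r z x j)) =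
         avg (cube n) (\<lambda>x. G x * (\<Prod>j\<in>J. u j x))"
  unfolding cube_eq_bool_cube
  by (rule avg_prod_drop_odd[of J b])
    (use J finite_subset[OF J] in \<open>auto simp: endpoint_less_n[OF b] r_flip_same[OF b] r_flip_other[OF b] G u v subset_iff\<close>)

text \<open>The sign of each pair averages out through the member that \<open>G\<close> ignores. So
  statistics free of all first members, or of all second members, have their uniform mean under the
  net.\<close>

lemma avg_mult_L:
  assumes "endpoint b" "\<And>j x. j < N \<Longrightarrow> G (flip (b j) x) = G x"
  shows "avg (cube n) (\<lambda>x. G x * L z x) = avg (cube n) G"
  using avg_prod_drop_r[of b "{..<N}" G "\<lambda>_ _. 1" "\<lambda>_ _. \<delta>" z] assms by (simp add: L_def)

lemma avg_L: "avg (cube n) (L z) = 1"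
  using avg_mult_L[of "\<lambda>j. 2 * j" "\<lambda>_. 1" z] by (simp add: endpoint_def avg_const)

text \<open>Both patterns are read at the same selectors, so \<open>r z' x j\<close> is
  \<open>r z x j\<close> times a sign \<open>s\<close> of the selectors alone. Multiplying out gives
  \<open>1 + \<delta>^2 * s\<close> plus a multiple of \<open>r z x j\<close>, which averages to
  zero.\<close>

lemma avg_L_mult_L:
  "avg (cube n) (\<lambda>x. L z x * L z' x) =
   avg (cube n) (\<lambda>x. \<Prod>j<N. 1 + \<delta>^2 * (sign (z (sel x, j)) * sign (z' (sel x, j))))"
proof -
  let ?b = "\<lambda>j::nat. 2 * j"
  have b: "endpoint ?b" by (simp add: endpoint_def)
  define s where "s j x = sign (z (sel x, j)) * sign (z' (sel x, j))" for j x
  have s: "s k (flip (?b j) x) = s k x" if "j < N" for j k x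
    using endpoint_less[OF b that] by (simp add: s_def)
  have r: "r z' x j = s j x * r z x j" for x j by (simp add: r_def s_def sign_def)
  have "L z x * L z' x = 1 * (\<Prod>j<N. (1 + \<delta>^2 * s j x) + (\<delta> * (1 + s j x)) * r z x j)" for x
    unfolding L_def prod.distrib[symmetric] mult_1
    by (intro prod.cong refl)
      (simp add: r algebra_simps power2_eq_square r_mult mult.left_commute[of _ "r z x _"] s_def[symmetric])
  thus ?thesis
    using avg_prod_drop_r[OF b order_refl, of "\<lambda>_. 1" "\<lambda>j x. 1 + \<delta>^2 * s j x" "\<lambda>j x. \<delta> * (1 + s j x)" z]
    by (simp add: s s_def)
qed

lemma avg_L_sq: "avg (cube n) (\<lambda>x. L z x * L z x) = (1 + \<delta>^2) ^ N"
  by (simp add: avg_L_mult_L avg_const)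

lemma avg_L_mult_sum_r: "avg (cube n) (\<lambda>x. L z x * (\<Sum>j<N. r z x j)) = N * \<delta>"
proof -
  have b: "endpoint (\<lambda>j. 2 * j)" by (simp add: endpoint_def)
  have "avg (cube n) (\<lambda>x. L z x * r z x i) = \<delta>" if i: "i < N" for i
  proof -
    \<comment> \<open>As \<open>r\<close> squares to 1, the factor at \<open>i\<close> becomes
      \<open>\<delta> + r z x i\<close>, and the whole has again the form that
      \<open>avg_prod_drop_r\<close> handles.\<close>
    have "L z x * r z x i = 1 * (\<Prod>j<N. (if j = i then \<delta> else 1) + (if j = i then 1 else \<delta>) * r z x j)" for x
    proof -
      have "L z x * r z x i = ((1 + \<delta> * r z x i) * r z x i) * (\<Prod>j\<in>{..<N}-{i}. 1 + \<delta> * r z x j)"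
        unfolding L_def by (subst prod.remove[of _ i]) (use i in auto)
      also have "(1 + \<delta> * r z x i) * r z x i = \<delta> + r z x i"
        using r_sq[of z x i] by (simp add: algebra_simps)
      finally show ?thesis
        by (subst prod.remove[of _ i]) (use i in \<open>auto intro!: prod.cong\<close>)
    qed
    hence "avg (cube n) (\<lambda>x. L z x * r z x i) = avg (cube n) (\<lambda>x. 1 * (\<Prod>j<N. if j = i then \<delta> else 1))"
      using avg_prod_drop_r[OF b order_refl, of "\<lambda>_. 1" "\<lambda>j x. if j = i then \<delta> else 1" "\<lambda>j x. if j = i then 1 else \<delta>" z]
      by simp
    thus ?thesis using i by (simp add: avg_const)
  qed
  thus ?thesis by (simp add: sum_distrib_left avg_sum)
qed

lemma avg_sum_r: "avg (cube n) (\<lambda>x. \<Sum>j<N. r z x j) = 0"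
  unfolding avg_sum cube_eq_bool_cube
proof (intro sum.neutral ballI)
  fix j assume j: "j \<in> {..<N}"
  have b: "endpoint (\<lambda>j. 2 * j)" by (simp add: endpoint_def)
  show "avg (bool_cube {..<n}) (\<lambda>x. r z x j) = 0"
    by (rule avg_odd[of "2 * j"]) (use r_flip_same[OF b] endpoint_less_n[OF b] j in auto)
qed

lemma avg_sum_r_pow4: "avg (cube n) (\<lambda>x. (\<Sum>j<N. r z x j) ^ 4) \<le> 3 * N^2"
proof -
  have b: "endpoint (\<lambda>j. 2 * j)" by (simp add: endpoint_def)
  show ?thesis
    using avg_sum_signs_sq[of "{..<N}" "\<lambda>j. 2 * j" "{..<n}" "\<lambda>j x. r z x j"]
      r_flip_same[OF b] endpoint_less_n[OF b] r_flip_other[OF b] r_sq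
    by (simp add: cube_eq_bool_cube)
qed

section \<open>Uniformity of the selectors\<close>

lemma finite_Sel [simp]: "finite Sel" and card_Sel: "card Sel = D"
  by (simp_all add: Sel_def)

lemma card_sel_eq:
  assumes "s \<subseteq> Sel"
  shows "card {x \<in> cube n. sel x = s} = 2 ^ (n - D)"
proof -
  \<comment> \<open>\<open>{i \<in> s}\<close> is the singleton of a truth value: selectors are
    fixed, all other bits are free.\<close>
  have "{x \<in> cube n. sel x = s} = PiE_dflt {..<n} False (\<lambda>i. if i \<in> Sel then {i \<in> s} else UNIV)"
    using assms size by (auto simp: cube_def PiE_dflt_def sel_def Sel_def split: if_splits)
  also have "card \<dots> = (\<Prod>i<n. if i \<in> Sel then 1 else 2)"
    by (subst card_PiE_dflt) (auto intro!: prod.cong)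
  also have "\<dots> = 2 ^ card ({..<n} - Sel)"
    by (simp add: prod.If_cases Diff_eq)
  also have "card ({..<n} - Sel) = n - D"
    using size by (subst card_Diff_subset) (auto simp: Sel_def)
  finally show ?thesis .
qed

lemma avg_sel: "avg (cube n) (\<lambda>x. F (sel x)) = (\<Sum>s\<in>Pow Sel. F s) / 2 ^ D"
proof -
  have "(\<Sum>x\<in>cube n. F (sel x)) = (\<Sum>s\<in>Pow Sel. \<Sum>x | x \<in> cube n \<and> sel x = s. F (sel x))"
    by (rule sum.group[symmetric]) (auto simp: sel_def)
  also have "\<dots> = (\<Sum>s\<in>Pow Sel. 2 ^ (n - D) * F s)"
    by (intro sum.cong refl) (simp add: card_sel_eq)
  also have "\<dots> = 2 ^ (n - D) * (\<Sum>s\<in>Pow Sel. F s)" by (simp add: sum_distrib_left)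
  finally have e: "(\<Sum>x\<in>cube n. F (sel x)) = 2 ^ (n - D) * (\<Sum>s\<in>Pow Sel. F s)" .
  have "(2::real) ^ n = 2 ^ (n - D) * 2 ^ D" using size by (simp add: power_add[symmetric])
  thus ?thesis unfolding avg_def e card_cube by simp
qed

section \<open>The second moment of the mixture\<close>

definition Z :: "(nat set \<times> nat \<Rightarrow> bool) set" where
  "Z = bool_cube (Pow Sel \<times> {..<N})"

lemma finite_Z [simp]: "finite Z" and Z_nonempty [simp]: "Z \<noteq> {}"
  by (simp_all add: Z_def)

text \<open>For fixed \<open>z\<close>, the products of the signs of \<open>z\<close> and
  \<open>z'\<close> are independent signs in \<open>z'\<close>, so
  \<open>avg_exp_sum_prod_le\<close> applies with \<open>\<eta> = \<delta>^2\<close>.\<close>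

lemma second_moment_le:
  "avg Z (\<lambda>z. avg Z (\<lambda>z'. avg (cube n) (\<lambda>x. L z x * L z' x) ^ m))
    \<le> exp (real m ^ 2 * N * ((1 + \<delta>^2) ^ N * \<delta>^2)^2 / (2 * 2 ^ D))"
proof -
  define t where "t = real m / 2 ^ D"
  define w where "w z k z' = sign (z k) * sign (z' k)" for z z' :: "nat set \<times> nat \<Rightarrow> bool" and k
  have "avg Z (\<lambda>z'. avg (cube n) (\<lambda>x. L z x * L z' x) ^ m)
    \<le> exp (real m ^ 2 * N * ((1 + \<delta>^2) ^ N * \<delta>^2)^2 / (2 * 2 ^ D))" for z
  proof -
    have "avg Z (\<lambda>z'. avg (cube n) (\<lambda>x. L z x * L z' x) ^ m)
      \<le> avg Z (\<lambda>z'. exp (- real m) * exp (t * (\<Sum>s\<in>Pow Sel. \<Prod>j<N. 1 + \<delta>^2 * w z (s, j) z')))"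
    proof (rule avg_mono)
      fix z'
      define a where "a = avg (cube n) (\<lambda>x. L z x * L z' x)"
      have "0 \<le> a" unfolding a_def avg_def by (intro divide_nonneg_nonneg sum_nonneg mult_nonneg_nonneg L_nonneg) auto
      moreover have "a \<le> exp (a - 1)" using exp_ge_add_one_self[of "a - 1"] by simp
      ultimately have "a ^ m \<le> exp (a - 1) ^ m" by (intro power_mono)
      also have "\<dots> = exp (- real m) * exp (real m * a)"
        by (simp add: exp_of_nat_mult[symmetric] exp_add[symmetric] algebra_simps)
      finally have le: "a ^ m \<le> exp (- real m) * exp (real m * a)" .
      have "a = (\<Sum>s\<in>Pow Sel. \<Prod>j<N. 1 + \<delta>^2 * w z (s, j) z') / 2 ^ D"
        unfolding a_def avg_L_mult_L w_def
        by (rule avg_sel[of "\<lambda>s. \<Prod>j<N. 1 + \<delta>^2 * (sign (z (s, j)) * sign (z' (s, j)))"])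
      hence "real m * a = t * (\<Sum>s\<in>Pow Sel. \<Prod>j<N. 1 + \<delta>^2 * w z (s, j) z')"
        by (simp add: t_def)
      with le show "avg (cube n) (\<lambda>x. L z x * L z' x) ^ m \<le>
          exp (- real m) * exp (t * (\<Sum>s\<in>Pow Sel. \<Prod>j<N. 1 + \<delta>^2 * w z (s, j) z'))"
        by (simp only: a_def)
    qed
    also have "\<dots> = exp (- real m) * avg Z (\<lambda>z'. exp (t * (\<Sum>s\<in>Pow Sel. \<Prod>j<N. 1 + \<delta>^2 * w z (s, j) z')))"
      by (rule avg_cmult)
    also have "\<dots> \<le> exp (- real m) * exp (t * card (Pow Sel)
        + card (Pow Sel) * card {..<N} * (t * (1 + \<delta>^2) ^ card {..<N} * \<delta>^2)^2 / 2)"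
      unfolding Z_def
      by (intro mult_left_mono avg_exp_sum_prod_le[of _ _ _ _ _ "\<lambda>k. k"])
        (auto simp: t_def w_def sign_def flip_def)
    \<comment> \<open>There are \<open>2 ^ D\<close> selector sets, so the linear term is
      \<open>t * 2 ^ D = m\<close> and cancels \<open>exp (- m)\<close>.\<close>
    also have "\<dots> = exp (real m ^ 2 * N * ((1 + \<delta>^2) ^ N * \<delta>^2)^2 / (2 * 2 ^ D))"
      unfolding exp_add[symmetric]
      by (simp add: card_Pow card_Sel t_def power2_eq_square mult_ac)
    finally show ?thesis .
  qed
  hence "avg Z (\<lambda>z. avg Z (\<lambda>z'. avg (cube n) (\<lambda>x. L z x * L z' x) ^ m))
    \<le> avg Z (\<lambda>z. exp (real m ^ 2 * N * ((1 + \<delta>^2) ^ N * \<delta>^2)^2 / (2 * 2 ^ D)))"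
    by (intro avg_mono)
  thus ?thesis by (simp add: avg_const)
qed

end

subsection \<open>Distance to product distributions\<close>

lemma prob_eq_avg:
  assumes "finite A" "set_pmf P \<subseteq> A" "\<And>x. x \<in> A \<Longrightarrow> pmf P x = f x / card A"
  shows "measure_pmf.prob P {x. Q x} = avg A (\<lambda>x. of_bool (Q x) * f x)"
proof -
  have "measure_pmf.prob P {x. Q x} = measure_pmf.prob P {x \<in> A. Q x}"
    using assms(2) by (intro measure_prob_cong_0) (auto simp: set_pmf_iff)
  also have "\<dots> = (\<Sum>x | x \<in> A \<and> Q x. pmf P x)"
    using assms(1) by (simp add: measure_measure_pmf_finite)
  also have "\<dots> = (\<Sum>x\<in>A. of_bool (Q x) * f x / card A)"
    using assms(1,3) by (intro sum.mono_neutral_cong_left) auto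
  finally show ?thesis by (simp add: avg_def sum_divide_distrib)
qed

text \<open>The indicator is 1/2 plus half of \<open>sign (x i) * sign c\<close>, which is odd under
  \<open>flip i\<close>.\<close>

lemma avg_coordinate:
  assumes "i \<in> A" "\<And>x. G (flip i x) = G x"
  shows "avg (bool_cube A) (\<lambda>x. G x * of_bool (x i = c)) = avg (bool_cube A) G / 2"
proof -
  have "avg (bool_cube A) (\<lambda>x. G x * of_bool (x i = c)) =
        avg (bool_cube A) (\<lambda>x. G x * (1/2) + G x * (sign (x i) * sign c / 2))"
    by (intro avg_cong) (auto simp: sign_def)
  also have "\<dots> = avg (bool_cube A) (\<lambda>x. G x * (1/2))"
    by (rule avg_drop_odd[OF assms(1)]) (simp add: assms(2))
  finally show ?thesis using avg_multc[of "bool_cube A" G "1/2"] by simp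
qed

section \<open>Gluing two independent copies along a block of coordinates\<close>

definition glue :: "nat set \<Rightarrow> (nat \<Rightarrow> bool) \<times> (nat \<Rightarrow> bool) \<Rightarrow> nat \<Rightarrow> bool" where
  "glue Y p i = (if i \<in> Y then snd p i else fst p i)"

text \<open>The first copy decides the coordinates off \<open>Y\<close> and the second those in
  \<open>Y\<close>, so the two blocks become independent and keep their marginals.\<close>

lemma pmf_glue:
  assumes P: "set_pmf P \<subseteq> cube n"
  shows "pmf (map_pmf (glue Y) (pair_pmf P P)) x = (if x \<in> cube n then
      measure_pmf.prob P {y. \<forall>i\<in>{..<n} - Y. y i = x i} * measure_pmf.prob P {y. \<forall>i\<in>{..<n} \<inter> Y. y i = x i} else 0)"
proof (cases "x \<in> cube n")
  case True
  let ?A = "{y \<in> cube n. \<forall>i\<in>{..<n} - Y. y i = x i}" and ?B = "{y \<in> cube n. \<forall>i\<in>{..<n} \<inter> Y. y i = x i}"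
  have fin: "finite (cube n)" by (simp add: cube_eq_bool_cube)
  have eq: "glue Y (a, b) = x \<longleftrightarrow> a \<in> ?A \<and> b \<in> ?B" if "a \<in> cube n" "b \<in> cube n" for a b
  proof -
    have "glue Y (a, b) i = x i" if "a \<in> ?A \<and> b \<in> ?B" for i
      using that True by (cases "i < n") (auto simp: glue_def cube_def PiE_dflt_def)
    moreover have "a \<in> ?A \<and> b \<in> ?B" if "glue Y (a, b) = x"
      using that \<open>a \<in> cube n\<close> \<open>b \<in> cube n\<close> by (auto simp: glue_def)
    ultimately show ?thesis by blast
  qed
  have out: "pmf (pair_pmf P P) (a, b) = 0" if "a \<notin> cube n \<or> b \<notin> cube n" for a b
  proof -
    have "pmf P a = 0 \<or> pmf P b = 0" using that P by (meson in_mono set_pmf_iff)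
    thus ?thesis by (auto simp: pmf_pair)
  qed
  \<comment> \<open>The preimage and the rectangle agree only on pairs of cube points; all other
    pairs have probability zero.\<close>
  have "pmf (map_pmf (glue Y) (pair_pmf P P)) x = measure_pmf.prob (pair_pmf P P) (?A \<times> ?B)"
    unfolding pmf_map
  proof (rule measure_prob_cong_0)
    fix p assume p: "p \<in> glue Y -` {x} - ?A \<times> ?B"
    obtain a b where ab: "p = (a, b)" by (cases p)
    have "\<not> (a \<in> cube n \<and> b \<in> cube n)" using p eq[of a b] unfolding ab by blast
    thus "pmf (pair_pmf P P) p = 0" using out unfolding ab by blast
  next
    fix p assume p: "p \<in> ?A \<times> ?B - glue Y -` {x}"
    obtain a b where ab: "p = (a, b)" by (cases p)
    have "\<not> (a \<in> cube n \<and> b \<in> cube n)" using p eq[of a b] unfolding ab by blast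
    thus "pmf (pair_pmf P P) p = 0" using out unfolding ab by blast
  qed
  also have "\<dots> = measure_pmf.prob P ?A * measure_pmf.prob P ?B"
    using fin by (intro measure_pmf_prob_product) (auto intro: countable_finite)
  also have "measure_pmf.prob P ?A = measure_pmf.prob P {y. \<forall>i\<in>{..<n} - Y. y i = x i}"
    using P by (intro measure_prob_cong_0) (auto simp: set_pmf_iff)
  also have "measure_pmf.prob P ?B = measure_pmf.prob P {y. \<forall>i\<in>{..<n} \<inter> Y. y i = x i}"
    using P by (intro measure_prob_cong_0) (auto simp: set_pmf_iff)
  finally show ?thesis using True by simp
next
  case False
  have "glue Y (a, b) \<noteq> x" if "a \<in> cube n" "b \<in> cube n" for a b
  proof
    assume "glue Y (a, b) = x"
    moreover have "glue Y (a, b) \<in> cube n" using that by (auto simp: glue_def cube_def PiE_dflt_def)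
    ultimately show False using False by simp
  qed
  hence "x \<notin> set_pmf (map_pmf (glue Y) (pair_pmf P P))" using P by fastforce
  thus ?thesis using False unfolding set_pmf_iff by simp
qed

lemma product_distribution_prob:
  assumes Q: "product_distribution n Q" and J: "J \<subseteq> {..<n}"
  shows "measure_pmf.prob Q {y. \<forall>i\<in>J. y i = x i} = (\<Prod>i\<in>J. measure_pmf.prob Q {y. y i = x i})"
proof (cases "J = {}")
  case False
  have "measure_pmf.prob Q (\<Inter>i\<in>J. (\<lambda>y. y i) -` {x i} \<inter> space (measure_pmf Q)) =
        (\<Prod>i\<in>J. measure_pmf.prob Q ((\<lambda>y. y i) -` {x i} \<inter> space (measure_pmf Q)))"
    using Q J False unfolding product_distribution_def
    by (intro prob_space.indep_varsD[OF measure_pmf.prob_space_axioms, where I="{..<n}" and M'="\<lambda>_. count_space UNIV"])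
       (auto intro: finite_subset)
  moreover have "(\<Inter>i\<in>J. (\<lambda>y. y i) -` {x i} \<inter> space (measure_pmf Q)) = {y. \<forall>i\<in>J. y i = x i}"
    using False by auto
  ultimately show ?thesis by (simp add: vimage_def)
qed simp

text \<open>Point probabilities are products of coordinate marginals, which split into the parts on
  and off \<open>Y\<close>.\<close>

lemma glue_product_distribution:
  assumes Q: "product_distribution n Q"
  shows "map_pmf (glue Y) (pair_pmf Q Q) = Q"
proof (rule pmf_eqI)
  fix x
  have supp: "set_pmf Q \<subseteq> cube n" using Q by (simp add: product_distribution_def)
  show "pmf (map_pmf (glue Y) (pair_pmf Q Q)) x = pmf Q x"
  proof (cases "x \<in> cube n")
    case True
    have "pmf Q x = measure_pmf.prob Q {x}" by (simp add: measure_pmf_single)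
    also have "\<dots> = measure_pmf.prob Q {y. \<forall>i\<in>{..<n}. y i = x i}"
    proof (rule measure_prob_cong_0)
      fix y assume y: "y \<in> {y. \<forall>i\<in>{..<n}. y i = x i} - {x}"
      hence "y \<notin> cube n" using True by (auto simp: cube_def PiE_dflt_def fun_eq_iff)
      thus "pmf Q y = 0" using supp by (auto simp: set_pmf_iff)
    qed auto
    also have "\<dots> = measure_pmf.prob Q {y. \<forall>i\<in>{..<n} - Y. y i = x i} * measure_pmf.prob Q {y. \<forall>i\<in>{..<n} \<inter> Y. y i = x i}"
      by (subst (1 2 3) product_distribution_prob[OF Q], simp, simp, simp)
         (subst mult.commute, rule prod.Int_Diff, simp)
    finally show ?thesis using True by (simp add: pmf_glue[OF supp])
  next
    case False
    thus ?thesis using supp by (auto simp: pmf_glue[OF supp] set_pmf_iff)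
  qed
qed

definition unif :: "nat \<Rightarrow> (nat \<Rightarrow> bool) pmf" where
  "unif n = pmf_of_set (cube n)"

lemma product_distribution_unif: "product_distribution n (unif n)"
proof -
  have "unif n = Pi_pmf {..<n} False (\<lambda>_. pmf_of_set UNIV)"
    unfolding unif_def cube_def by (rule Pi_pmf_of_set[symmetric]) auto
  moreover have "set_pmf (unif n) \<subseteq> cube n"
    unfolding unif_def by (simp add: cube_eq_bool_cube)
  ultimately show ?thesis
    unfolding product_distribution_def using indep_vars_Pi_pmf[of "{..<n}" False "\<lambda>_. pmf_of_set UNIV"] by simp
qed

context paired_construction
begin

definition P :: "(nat set \<times> nat \<Rightarrow> bool) \<Rightarrow> (nat \<Rightarrow> bool) pmf" where
  "P z = embed_pmf (\<lambda>x. if x \<in> cube n then L z x / 2 ^ n else 0)"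

lemma pmf_P: "pmf (P z) x = (if x \<in> cube n then L z x / 2 ^ n else 0)"
  unfolding P_def
proof (rule pmf_embed_pmf)
  show "0 \<le> (if x \<in> cube n then L z x / 2 ^ n else 0)" for x by (simp add: L_nonneg)
  have "(\<integral>\<^sup>+x. ennreal (if x \<in> cube n then L z x / 2 ^ n else 0) \<partial>count_space UNIV) =
    (\<Sum>x\<in>cube n. ennreal (L z x / 2 ^ n))"
    by (subst nn_integral_count_space'[of "cube n"]) auto
  also have "\<dots> = ennreal (avg (cube n) (L z))"
    by (simp add: sum_ennreal L_nonneg avg_def card_cube sum_divide_distrib)
  finally show "(\<integral>\<^sup>+x. ennreal (if x \<in> cube n then L z x / 2 ^ n else 0) \<partial>count_space UNIV) = 1"
    by (simp add: avg_L)
qed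

lemma set_pmf_P: "set_pmf (P z) \<subseteq> cube n"
  by (auto simp: set_pmf_eq pmf_P split: if_splits)

lemma prob_P: "measure_pmf.prob (P z) {x. Q x} = avg (cube n) (\<lambda>x. of_bool (Q x) * L z x)"
  by (rule prob_eq_avg) (use set_pmf_P in \<open>auto simp: pmf_P card_cube\<close>)

lemma pmf_unif: "pmf (unif n) x = (if x \<in> cube n then 1 / 2 ^ n else 0)"
  by (simp add: unif_def card_cube)

lemma prob_unif: "measure_pmf.prob (unif n) {x. Q x} = avg (cube n) (\<lambda>x. of_bool (Q x))"
  using prob_eq_avg[of "cube n" "unif n" "\<lambda>_. 1" Q] by (simp add: pmf_unif card_cube) (simp add: unif_def)

text \<open>Only two marginals matter: the one off the second members is uniform by flipping second
  members, the one on them by flipping first members.\<close>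

lemma glue_P: "map_pmf (glue ((\<lambda>j. 2 * j + 1) ` {..<N})) (pair_pmf (P z) (P z)) = unif n"
proof -
  let ?Y = "(\<lambda>j. 2 * j + 1) ` {..<N}"
  have 1: "measure_pmf.prob (P z) {y. \<forall>i\<in>{..<n} - ?Y. y i = x i} =
        measure_pmf.prob (unif n) {y. \<forall>i\<in>{..<n} - ?Y. y i = x i}" for x
    unfolding prob_P prob_unif
    by (rule avg_mult_L[of "\<lambda>j. 2 * j + 1"]) (auto simp: endpoint_def flip_def intro!: arg_cong[where f=of_bool])
  have 2: "measure_pmf.prob (P z) {y. \<forall>i\<in>{..<n} \<inter> ?Y. y i = x i} =
        measure_pmf.prob (unif n) {y. \<forall>i\<in>{..<n} \<inter> ?Y. y i = x i}" for x
    unfolding prob_P prob_unif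
  proof (rule avg_mult_L[of "\<lambda>j. 2 * j"])
    fix j y
    have "flip (2 * j) y i = y i" if "i \<in> ?Y" for i using that by (auto simp: flip_def; presburger)
    thus "of_bool (\<forall>i\<in>{..<n} \<inter> ?Y. flip (2 * j) y i = x i) = of_bool (\<forall>i\<in>{..<n} \<inter> ?Y. y i = x i)" by simp
  qed (simp add: endpoint_def)
  have U: "set_pmf (unif n) \<subseteq> cube n" by (simp add: unif_def)
  have "map_pmf (glue ?Y) (pair_pmf (P z) (P z)) = map_pmf (glue ?Y) (pair_pmf (unif n) (unif n))"
    by (rule pmf_eqI) (simp only: pmf_glue[OF set_pmf_P] pmf_glue[OF U] 1 2)
  thus ?thesis by (simp add: glue_product_distribution[OF product_distribution_unif])
qed

text \<open>
  Drawing the second members of all pairs from an independent copy leaves every product distribution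
  unchanged but turns \<open>P z\<close> into the uniform distribution, and it costs at most twice the distance.
\<close>

lemma tv_dist_P_unif_le:
  assumes Q: "product_distribution n Q"
  shows "tv_dist (P z) (unif n) \<le> 3 * tv_dist (P z) Q"
proof -
  define g where "g = glue ((\<lambda>j. 2 * j + 1) ` {..<N})"
  have "tv_dist Q (unif n) = tv_dist (map_pmf g (pair_pmf Q Q)) (map_pmf g (pair_pmf (P z) (P z)))"
    unfolding g_def glue_P glue_product_distribution[OF Q] ..
  also have "\<dots> \<le> 2 * tv_dist Q (P z)" by (rule order_trans[OF tv_dist_map_pmf tv_dist_pair_pmf])
  finally show ?thesis
    using tv_dist_triangle[of "P z" "unif n" Q] by (simp add: tv_dist_commute[of Q])
qed

text \<open>The event \<open>L z x \<ge> 1\<close> is where the net outweighs the uniform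
  distribution. As \<open>L - 1\<close> has mean zero, its absolute value averages to twice its
  positive part.\<close>

lemma tv_dist_P_unif_ge: "avg (cube n) (\<lambda>x. \<bar>L z x - 1\<bar>) / 2 \<le> tv_dist (P z) (unif n)"
proof -
  have "avg (cube n) (\<lambda>x. \<bar>L z x - 1\<bar>) = avg (cube n) (\<lambda>x. 2 * (of_bool (L z x \<ge> 1) * L z x - of_bool (L z x \<ge> 1)) - (L z x - 1))"
    by (intro avg_cong) auto
  also have "\<dots> = 2 * (measure_pmf.prob (P z) {x. L z x \<ge> 1} - measure_pmf.prob (unif n) {x. L z x \<ge> 1})"
    unfolding avg_diff avg_cmult prob_P prob_unif by (simp add: avg_L avg_const)
  also have "\<dots> \<le> 2 * tv_dist (P z) (unif n)"
    using abs_prob_diff_le_tv_dist[of "P z" "{x. L z x \<ge> 1}" "unif n"]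
    by (intro mult_left_mono) (auto dest: abs_le_D1)
  finally show ?thesis by simp
qed

text \<open>
  The average of \<open>(L - 1) * W\<close> is \<open>N * \<delta>\<close> for \<open>W\<close> the sum of the signs. AM-GM twice, with parameters
  balanced by \<open>s = sqrt N\<close> and \<open>a = s / \<delta>\<close>, bounds it by \<open>\<bar>L - 1\<bar>\<close> times \<open>5 * s / 2\<close> plus
  moment terms that average to at most \<open>N * \<delta> / 4\<close>.
\<close>

lemma avg_abs_L_minus_1_ge:
  assumes N: "0 < N" "0 < \<delta>" "N * \<delta>^2 \<le> 1"
  shows "3 / 10 * (sqrt N * \<delta>) \<le> avg (cube n) (\<lambda>x. \<bar>L z x - 1\<bar>)"
proof -
  define s where "s = sqrt N"
  define a where "a = s / \<delta>"
  define W where "W x = (\<Sum>j<N. r z x j)" for x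
  have s: "s > 0" "s * s = N" using N by (simp_all add: s_def)
  have a: "a > 0" using s N by (simp add: a_def)
  have "s * s * \<delta> = avg (cube n) (\<lambda>x. L z x * W x - W x)"
    unfolding avg_diff by (simp add: W_def avg_sum_r avg_L_mult_sum_r s)
  also have "\<dots> \<le> avg (cube n) (\<lambda>x. \<bar>L z x - 1\<bar> * (5 * s / 2) + ((L z x * L z x - 2 * L z x + 1) * a + W x ^ 4 * (1 / a)) * (1 / (20 * s)))"
  proof (rule avg_mono)
    fix x
    define y where "y = \<bar>L z x - 1\<bar>"
    define w where "w = \<bar>W x\<bar>"
    have nn: "y \<ge> 0" "w \<ge> 0" by (simp_all add: y_def w_def)
    have "w * (10 * s) \<le> 25 * (s * s) + w * w"
      using zero_le_power2[of "w - 5 * s"] unfolding power2_diff by (simp add: power2_eq_square algebra_simps)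
    hence "w \<le> 5 * s / 2 + w * w * (1 / (10 * s))" using s by (simp add: field_simps)
    hence 1: "y * w \<le> y * (5 * s / 2) + (y * (w * w)) * (1 / (10 * s))"
      using mult_left_mono[OF _ nn(1)] by (fastforce simp: algebra_simps)
    have "2 * (y * a) * (w * w) \<le> (y * a) * (y * a) + (w * w) * (w * w)"
      using zero_le_power2[of "y * a - w * w"] unfolding power2_diff by (simp add: power2_eq_square)
    hence "y * (w * w) \<le> (y * y * a + (w * w) * (w * w) * (1 / a)) * (1/2)"
      using a by (simp add: field_simps)
    hence "(y * (w * w)) * (1 / (10 * s)) \<le> (y * y * a + (w * w) * (w * w) * (1 / a)) * (1/2) * (1 / (10 * s))"
      using s by (intro mult_right_mono) auto
    with 1 have 2: "y * w \<le> y * (5 * s / 2) + (y * y * a + (w * w) * (w * w) * (1 / a)) * (1 / (20 * s))"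
      by simp
    have "L z x * W x - W x = (L z x - 1) * W x" by (simp add: algebra_simps)
    also have "\<dots> \<le> y * w" unfolding y_def w_def abs_mult[symmetric] by (rule abs_ge_self)
    finally have 3: "L z x * W x - W x \<le> y * w" .
    have "y * y = L z x * L z x - 2 * L z x + 1" by (simp add: y_def abs_mult[symmetric] algebra_simps)
    moreover have "(w * w) * (w * w) = W x ^ 4" by (simp add: w_def abs_mult[symmetric] power4_eq_xxxx mult.assoc)
    ultimately show "L z x * W x - W x \<le> \<bar>L z x - 1\<bar> * (5 * s / 2) + ((L z x * L z x - 2 * L z x + 1) * a + W x ^ 4 * (1 / a)) * (1 / (20 * s))"
      using 2 3 by (simp add: y_def)
  qed
  also have "\<dots> = avg (cube n) (\<lambda>x. \<bar>L z x - 1\<bar>) * (5 * s / 2) + (((1 + \<delta>^2) ^ N - 1) * a + avg (cube n) (\<lambda>x. W x ^ 4) * (1 / a)) * (1 / (20 * s))"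
    by (simp only: avg_add avg_multc avg_diff avg_cmult avg_L_sq avg_L avg_const[OF finite_cube cube_nonempty])
       (simp add: algebra_simps)
  also have "\<dots> \<le> avg (cube n) (\<lambda>x. \<bar>L z x - 1\<bar>) * (5 * s / 2) + ((2 * (s * s * \<delta>^2)) * a + (3 * (s * s) ^ 2) * (1 / a)) * (1 / (20 * s))"
  proof -
    \<comment> \<open>With \<open>u = N * \<delta>^2 \<le> 1\<close>, the chain is
      \<open>exp u \<le> 1 + u + u^2 \<le> 1 + 2 * u\<close>.\<close>
    have "(1 + \<delta>^2) ^ N \<le> exp (\<delta>^2) ^ N" by (intro power_mono) auto
    also have "\<dots> = exp (N * \<delta>^2)" by (simp add: exp_of_nat_mult[symmetric])
    also have "\<dots> \<le> 1 + N * \<delta>^2 + (N * \<delta>^2)^2" using N by (intro exp_bound) auto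
    also have "(N * \<delta>^2)^2 \<le> N * \<delta>^2" using N by (simp add: power2_eq_square mult_left_le)
    finally have "(1 + \<delta>^2) ^ N - 1 \<le> 2 * (s * s * \<delta>^2)" using s by simp
    moreover have "avg (cube n) (\<lambda>x. W x ^ 4) \<le> 3 * (s * s) ^ 2"
      using avg_sum_r_pow4[of z] s by (simp add: W_def)
    ultimately show ?thesis using a s by (intro add_left_mono mult_right_mono add_mono) auto
  qed
  \<comment> \<open>By the choice of \<open>a\<close> the two terms are
    \<open>2 * s^3 * \<delta>\<close> and \<open>3 * s^3 * \<delta>\<close>.\<close>
  also have "((2 * (s * s * \<delta>^2)) * a + (3 * (s * s) ^ 2) * (1 / a)) * (1 / (20 * s)) = s * s * \<delta> / 4"
    using s N by (simp add: a_def field_simps power2_eq_square)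
  \<comment> \<open>Three quarters of \<open>s * s * \<delta>\<close> remain; division by the
    coefficient \<open>5 * s / 2\<close> gives 3/10.\<close>
  finally have "s * (3 / 10 * (s * \<delta>)) \<le> s * avg (cube n) (\<lambda>x. \<bar>L z x - 1\<bar>)"
    by (simp add: field_simps)
  thus ?thesis using s by (simp add: s_def)
qed

text \<open>The 1/20 is 3/10 divided by 2, for passing from the L1 norm to total variation, and by
  3, for passing from the uniform to any product distribution.\<close>

lemma P_far_from_product:
  assumes "0 < N" "0 < \<delta>" "N * \<delta>^2 \<le> 1" "product_distribution n Q"
  shows "sqrt N * \<delta> / 20 \<le> tv_dist (P z) Q"
  using avg_abs_L_minus_1_ge[OF assms(1-3), of z] tv_dist_P_unif_ge[of z] tv_dist_P_unif_le[OF assms(4), of z]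
  by simp

end

subsection \<open>The Bayes net structure\<close>

context paired_construction
begin

text \<open>Depends on \<open>N\<close> and \<open>D\<close> only, so one graph serves all sign
  patterns and all \<open>\<delta>\<close>.\<close>

definition E :: "(nat \<times> nat) set" where
  "E = {(i, 2 * j + 1) | i j. j < N \<and> (i = 2 * j \<or> i \<in> Sel)}"

lemma parents_child: "j < N \<Longrightarrow> parents E (2 * j + 1) = insert (2 * j) Sel"
  by (auto simp: parents_def E_def)

lemma parents_other: "i \<notin> (\<lambda>j. 2 * j + 1) ` {..<N} \<Longrightarrow> parents E i = {}"
  by (auto simp: parents_def E_def)

lemma degree_dag_E: "degree_dag n (Suc D) E"
  unfolding degree_dag_def
proof (intro conjI allI impI)
  show "E \<subseteq> {..<n} \<times> {..<n}" using size by (auto simp: E_def Sel_def)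
  show "acyclic E"
    \<comment> \<open>Every edge falls from rank 1 to rank 0; the test \<open>i < 2 * N\<close>
      keeps odd selectors at rank 1.\<close>
    by (rule acyclicI_order[where f="\<lambda>i. if i < 2 * N \<and> odd i then 0 else 1 :: nat"])
       (auto simp: E_def Sel_def)
  fix i
  show "card (parents E i) \<le> Suc D"
  proof (cases "i \<in> (\<lambda>j. 2 * j + 1) ` {..<N}")
    case True
    then obtain j where "i = 2 * j + 1" "j < N" by auto
    thus ?thesis using card_insert_le_m1[of "Suc D" Sel "2 * j"] card_Sel parents_child[of j] by simp
  next
    case False
    thus ?thesis by (simp add: parents_other)
  qed
qed

lemma cond_prob_root:
  assumes i: "i < n" "i \<notin> (\<lambda>j. 2 * j + 1) ` {..<N}"
  shows "\<P>(y in P z. y i = x i \<bar> \<forall>j\<in>parents E i. y j = x j) = 1 / 2"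
proof -
  have "measure_pmf.prob (P z) {y. y i = x i} = avg (cube n) (\<lambda>y. of_bool (y i = x i))"
    unfolding prob_P
    by (rule avg_mult_L[of "\<lambda>j. 2 * j + 1"]) (use i in \<open>auto simp: endpoint_def flip_def\<close>)
  also have "\<dots> = 1 / 2"
    using avg_coordinate[of i "{..<n}" "\<lambda>_. 1" "x i"] i by (simp add: cube_eq_bool_cube avg_const)
  finally show ?thesis by (simp add: cond_prob_def parents_other[OF i(2)])
qed

text \<open>In the numerator the factors of the other pairs average to 1, the factor of pair
  \<open>j\<close> is fixed by the event, and the bit itself costs 1/2. The denominator is free of
  second members, hence uniform.\<close>

lemma cond_prob_child:
  assumes x: "x \<in> cube n" and j: "j < N"
  shows "\<P>(y in P z. y (2 * j + 1) = x (2 * j + 1) \<bar> \<forall>k\<in>parents E (2 * j + 1). y k = x k) = (1 + \<delta> * r z x j) / 2"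
proof -
  let ?b = "\<lambda>j::nat. 2 * j + 1"
  have b: "endpoint ?b" by (simp add: endpoint_def)
  define R where "R y \<longleftrightarrow> (\<forall>k\<in>insert (2 * j) Sel. y k = x k)" for y
  have R: "R (flip (?b k) y) = R y" if "k < N" for k y
  proof -
    have "flip (?b k) y i = y i" if "i \<in> insert (2 * j) Sel" for i
      using that \<open>k < N\<close> by (auto simp: flip_def Sel_def; presburger)
    thus ?thesis by (simp add: R_def)
  qed
  have num: "measure_pmf.prob (P z) {y. y (?b j) = x (?b j) \<and> R y} = (1 + \<delta> * r z x j) * avg (cube n) (\<lambda>y. of_bool (R y)) / 2"
  proof -
    define G where "G y = of_bool (y (?b j) = x (?b j) \<and> R y) * (1 + \<delta> * r z y j)" for y
    have "of_bool (y (?b j) = x (?b j) \<and> R y) * L z y = G y * (\<Prod>k\<in>{..<N} - {j}. 1 + \<delta> * r z y k)" for y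
      unfolding L_def G_def by (subst prod.remove[of _ j]) (use j in auto)
    hence "measure_pmf.prob (P z) {y. y (?b j) = x (?b j) \<and> R y} = avg (cube n) (\<lambda>y. G y * (\<Prod>k\<in>{..<N} - {j}. 1 + \<delta> * r z y k))"
      unfolding prob_P by simp
    also have "\<dots> = avg (cube n) (\<lambda>y. G y * (\<Prod>k\<in>{..<N} - {j}. 1))"
    proof (rule avg_prod_drop_r[OF b])
      fix k y assume k: "k \<in> {..<N} - {j}"
      show "G (flip (?b k) y) = G y"
        using k R[of k y] r_flip_other[OF b, of k j z y] by (simp add: G_def)
    qed auto
    also have "\<dots> = avg (cube n) (\<lambda>y. (1 + \<delta> * r z x j) * (of_bool (R y) * of_bool (y (?b j) = x (?b j))))"
    proof (rule avg_cong)
      fix y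
      have "r z y j = r z x j" if "R y" "y (?b j) = x (?b j)"
      proof -
        have "sel y = sel x" using that by (auto simp: sel_def R_def)
        thus ?thesis using that by (simp add: r_def R_def)
      qed
      thus "G y * (\<Prod>k\<in>{..<N} - {j}. 1) = (1 + \<delta> * r z x j) * (of_bool (R y) * of_bool (y (?b j) = x (?b j)))"
        by (auto simp: G_def)
    qed
    also have "\<dots> = (1 + \<delta> * r z x j) * (avg (cube n) (\<lambda>y. of_bool (R y)) / 2)"
      unfolding avg_cmult cube_eq_bool_cube
      by (subst avg_coordinate) (use R[OF j] endpoint_less_n[OF b j] in auto)
    finally show ?thesis by simp
  qed
  have den: "measure_pmf.prob (P z) {y. R y} = avg (cube n) (\<lambda>y. of_bool (R y))"
    unfolding prob_P by (rule avg_mult_L[OF b]) (simp only: R)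
  \<comment> \<open>The point \<open>x\<close> satisfies \<open>R\<close>, so the conditioning event
    is not null.\<close>
  have "0 < (\<Sum>y\<in>cube n. of_bool (R y) :: real)"
    by (rule sum_pos2[OF _ x]) (auto simp: R_def)
  hence "avg (cube n) (\<lambda>y. of_bool (R y)) > 0" by (simp add: avg_def card_cube)
  moreover have "\<P>(y in P z. y (?b j) = x (?b j) \<bar> \<forall>k\<in>parents E (?b j). y k = x k) =
      measure_pmf.prob (P z) {y. y (?b j) = x (?b j) \<and> R y} / measure_pmf.prob (P z) {y. R y}"
    unfolding cond_prob_def parents_child[OF j] R_def[symmetric] by simp
  ultimately show ?thesis unfolding num den by simp
qed

text \<open>The \<open>n - N\<close> roots contribute 1/2 each, and the \<open>N\<close> second
  members contribute the halved factors of \<open>L z x\<close>.\<close>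

lemma bayes_net_on_P: "bayes_net_on n E (P z)"
  unfolding bayes_net_on_def
proof (intro conjI ballI set_pmf_P)
  fix x assume x: "x \<in> cube n"
  let ?C = "(\<lambda>j. 2 * j + 1) ` {..<N}"
  have C: "?C \<subseteq> {..<n}" using size by auto
  define f where "f i = \<P>(y in P z. y i = x i \<bar> \<forall>j\<in>parents E i. y j = x j)" for i
  have "(\<Prod>i<n. f i) = (\<Prod>i\<in>{..<n} - ?C. f i) * (\<Prod>i\<in>?C. f i)"
    by (rule prod.subset_diff[OF C]) simp
  also have "(\<Prod>i\<in>{..<n} - ?C. f i) = (\<Prod>i\<in>{..<n} - ?C. 1 / 2)"
    by (intro prod.cong refl) (simp add: f_def cond_prob_root)
  also have "\<dots> = (1 / 2) ^ (n - N)"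
    using C by (simp add: card_Diff_subset card_image inj_on_def)
  also have "(\<Prod>i\<in>?C. f i) = (\<Prod>j<N. (1 + \<delta> * r z x j) / 2)"
    by (subst prod.reindex) (auto simp: inj_on_def f_def cond_prob_child[OF x, simplified] intro!: prod.cong)
  also have "\<dots> = L z x * (1 / 2) ^ N"
    by (simp add: L_def prod_dividef power_divide)
  also have "(1 / 2) ^ (n - N) * (L z x * (1 / 2) ^ N) = L z x * (1 / 2 :: real) ^ (n - N + N)"
    by (simp add: power_add)
  also have "n - N + N = n" using size by simp
  finally show "pmf (P z) x = (\<Prod>i<n. f i)" using x by (simp add: pmf_P power_divide)
qed

end

section \<open>Choice of parameters and the sample lower bound\<close>

lemma bayes_net_on_unif:
  assumes "paired_construction n N D \<delta>"
  shows "bayes_net_on n (paired_construction.E N D) (unif n)"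
proof -
  interpret p: paired_construction n N D \<delta> by fact
  \<comment> \<open>At \<open>\<delta> = 0\<close> the density \<open>L\<close> is 1, so the net is
    uniform, and its graph is the same \<open>E\<close>.\<close>
  interpret q: paired_construction n N D 0 using p.size by unfold_locales auto
  have "q.P z = unif n" for z
    by (rule pmf_eqI) (simp add: q.pmf_P q.L_def p.pmf_unif)
  thus ?thesis using q.bayes_net_on_P by simp
qed

text \<open>One graph carries both the uniform distribution and all the far nets, so a tester that
  knows it still has to tell them apart.\<close>

lemma known_structure_lower_bound:
  fixes n d m :: nat and \<epsilon> :: real
  assumes d: "1 \<le> d" "real d \<le> real n / 2" and eps: "0 < \<epsilon>" "\<epsilon> \<le> 1 / 20"
  shows "\<exists>E. degree_dag n d E \<and>
         (\<forall>m T. independence_tester n \<epsilon> (bayes_net_on n E) m T \<longrightarrow>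
            real m \<ge> 1 / 12000 * (2 powr (real d / 2) * sqrt (real n) / \<epsilon>\<^sup>2))"
proof -
  \<comment> \<open>The first member of the pair takes up one of the \<open>d\<close>
    parents.\<close>
  define D where "D = d - 1"
  define N where "N = (n - D) div 2"
  \<comment> \<open>Makes the distance bound \<open>sqrt N * \<delta> / 20\<close> equal to
    \<open>\<epsilon>\<close>; then \<open>\<epsilon> \<le> 1 / 20\<close> ensures
    \<open>N * \<delta>^2 \<le> 1\<close>.\<close>
  define \<delta> where "\<delta> = 20 * \<epsilon> / sqrt N"
  have dn: "2 * d \<le> n" using d(2) by linarith
  have nN: "n \<le> 4 * N" "0 < N" "2 * N + D \<le> n"
    using d(1) dn by (auto simp: N_def D_def)
  have sN: "sqrt N \<ge> 1" using nN by simp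
  have d1: "N * \<delta>^2 = (20 * \<epsilon>)^2" using nN by (simp add: \<delta>_def power_divide)
  have d2: "N * \<delta>^2 \<le> 1" unfolding d1 by (rule power_le_one) (use eps in auto)
  have dpos: "0 < \<delta>" using eps nN by (simp add: \<delta>_def)
  have "\<delta> \<le> 1 / 1" unfolding \<delta>_def using eps sN by (intro frac_le) auto
  interpret paired_construction n N D \<delta>
    by unfold_locales (use nN dpos \<open>\<delta> \<le> 1 / 1\<close> in auto)
  show ?thesis
  proof (intro exI[of _ "paired_construction.E N D"] conjI allI impI)
    show "degree_dag n d E" using degree_dag_E d(1) by (simp add: D_def)
    fix m T assume T: "independence_tester n \<epsilon> (bayes_net_on n E) m T"
    have null: "pmf (bind_pmf (replicate_pmf m (pmf_of_set (cube n))) T) True \<ge> 2/3"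
      using T bayes_net_on_unif[OF paired_construction_axioms] product_distribution_unif[of n]
      unfolding independence_tester_def unif_def by blast
    have alt: "pmf (bind_pmf (replicate_pmf m (P z)) T) False \<ge> 2/3" for z
    proof -
      have "\<epsilon> \<le> tv_dist (P z) Q" if "product_distribution n Q" for Q
        using P_far_from_product[OF nN(2) dpos d2 that, of z] nN by (simp add: \<delta>_def)
      thus ?thesis using T bayes_net_on_P[of z] unfolding independence_tester_def by blast
    qed
    define X where "X = real m ^ 2 * N * ((1 + \<delta>^2) ^ N * \<delta>^2)^2 / (2 * 2 ^ D)"
    have "10 / 9 \<le> avg Z (\<lambda>z. avg Z (\<lambda>z'. avg (cube n) (\<lambda>x. L z x * L z' x) ^ m))"
      by (rule mixture_second_moment_lower_bound[where P=P and T=T])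
        (use set_pmf_P null alt in \<open>auto simp: pmf_P card_cube avg_L\<close>)
    also have "\<dots> \<le> exp X" unfolding X_def by (rule second_moment_le)
    finally have "10 / 9 \<le> exp X" .
    \<comment> \<open>The threshold works because \<open>exp (1 / 20)\<close> is still below
      10/9.\<close>
    have X: "1 / 20 \<le> X"
    proof (rule ccontr)
      assume "\<not> 1 / 20 \<le> X"
      hence "exp X \<le> exp (1 / 20)" by simp
      also have "\<dots> \<le> 1 + 1 / 20 + (1 / 20)^2" by (rule exp_bound) auto
      also have "\<dots> < 10 / 9" by (simp add: power2_eq_square)
      finally show False using \<open>10 / 9 \<le> exp X\<close> by simp
    qed
    have "(1 + \<delta>^2) ^ N \<le> exp (\<delta>^2) ^ N" by (intro power_mono) auto
    also have "\<dots> = exp (N * \<delta>^2)" by (simp add: exp_of_nat_mult[symmetric])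
    also have "\<dots> \<le> exp 1" using d2 by simp
    also have "\<dots> \<le> 3" using exp_le by simp
    finally have B: "(1 + \<delta>^2) ^ N \<le> 3" .
    have "X \<le> real m ^ 2 * N * (3 * \<delta>^2)^2 / (2 * 2 ^ D)"
      unfolding X_def using B by (intro divide_right_mono mult_left_mono power_mono mult_right_mono) auto
    also have "\<dots> = 9 * real m ^ 2 * (N * \<delta>^2)^2 / (N * 2 ^ d)"
      using nN d(1) by (cases d) (auto simp: D_def field_simps power2_eq_square)
    also have "\<dots> = 9 * real m ^ 2 * (20 * \<epsilon>)^4 / (N * 2 ^ d)"
      unfolding d1 by (simp add: power_mult[symmetric])
    finally have "1 / 20 \<le> 9 * real m ^ 2 * (20 * \<epsilon>)^4 / (N * 2 ^ d)" using X by simp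
    hence "N * 2 ^ d \<le> 180 * real m ^ 2 * (20 * \<epsilon>)^4"
      using nN by (simp add: field_simps)
    hence le: "real (N * 2 ^ d) \<le> 180 * real m ^ 2 * (20 * \<epsilon>)^4" by simp
    have "real n * 2 ^ d \<le> real (4 * N) * 2 ^ d" using nN by (intro mult_right_mono) auto
    also have "\<dots> = 4 * real (N * 2 ^ d)" by simp
    also have "\<dots> \<le> 4 * (180 * real m ^ 2 * (20 * \<epsilon>)^4)" using le by (intro mult_left_mono) auto
    also have "\<dots> = 720 * real m ^ 2 * (20 * \<epsilon>)^4" by simp
    \<comment> \<open>Rounding up to 900 makes the right side a square, with root constant
      \<open>30 * 20^2 = 12000\<close>.\<close>
    also have "\<dots> \<le> 900 * real m ^ 2 * (20 * \<epsilon>)^4" by (intro mult_right_mono) auto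
    also have "\<dots> = (12000 * \<epsilon>^2 * real m)^2"
      by (simp add: power_mult_distrib power_mult[symmetric])
    finally have "sqrt (real n * 2 ^ d) \<le> 12000 * \<epsilon>^2 * real m"
      by (intro real_le_lsqrt) auto
    moreover have "sqrt (real n * 2 ^ d) = 2 powr (real d / 2) * sqrt (real n)"
      by (simp add: real_sqrt_mult powr_half_sqrt_powr powr_realpow)
    ultimately show "real m \<ge> 1 / 12000 * (2 powr (real d / 2) * sqrt (real n) / \<epsilon>\<^sup>2)"
      using eps by (simp add: field_simps)
  qed
qed

text \<open>A tester for all degree-\<open>d\<close> nets is in particular one for the nets on the
  hard graph, so both bounds come from the case of known structure.\<close>

theorem theoremB3:
  shows "\<exists>(c::real) (\<epsilon>\<^sub>0::real). c > 0 \<and> \<epsilon>\<^sub>0 > 0 \<and> (\<forall>(n::nat) (d::nat) (\<epsilon>::real).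
    1 \<le> d \<and> real d \<le> real n / 2 \<and> \<epsilon> \<in> {0<..1} \<and> \<epsilon> \<le> \<epsilon>\<^sub>0 \<longrightarrow>
      (\<forall>m T. independence_tester n \<epsilon> (degree_bayes_net n d) m T \<longrightarrow>
         real m \<ge> c * (2 powr (real d / 2) * sqrt (real n) / \<epsilon>\<^sup>2)) \<and>
      (\<exists>E. degree_dag n d E \<and>
         (\<forall>m T. independence_tester n \<epsilon> (bayes_net_on n E) m T \<longrightarrow>
            real m \<ge> c * (2 powr (real d / 2) * sqrt (real n) / \<epsilon>\<^sup>2))))"
proof (rule exI[of _ "1 / 12000"], rule exI[of _ "1 / 20"], intro conjI allI impI)
  fix n d m :: nat and \<epsilon> :: real and T
  assume *: "1 \<le> d \<and> real d \<le> real n / 2 \<and> \<epsilon> \<in> {0<..1} \<and> \<epsilon> \<le> 1 / 20"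
    and T: "independence_tester n \<epsilon> (degree_bayes_net n d) m T"
  obtain E where E: "degree_dag n d E" and lb: "\<And>m T. independence_tester n \<epsilon> (bayes_net_on n E) m T \<Longrightarrow>
            real m \<ge> 1 / 12000 * (2 powr (real d / 2) * sqrt (real n) / \<epsilon>\<^sup>2)"
    using known_structure_lower_bound[of d n \<epsilon>] * by auto
  have "independence_tester n \<epsilon> (bayes_net_on n E) m T"
    using T E unfolding independence_tester_def degree_bayes_net_def by blast
  thus "real m \<ge> 1 / 12000 * (2 powr (real d / 2) * sqrt (real n) / \<epsilon>\<^sup>2)" by (rule lb)
next
  fix n d :: nat and \<epsilon> :: real
  assume "1 \<le> d \<and> real d \<le> real n / 2 \<and> \<epsilon> \<in> {0<..1} \<and> \<epsilon> \<le> 1 / 20"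
  thus "\<exists>E. degree_dag n d E \<and>
         (\<forall>m T. independence_tester n \<epsilon> (bayes_net_on n E) m T \<longrightarrow>
            real m \<ge> 1 / 12000 * (2 powr (real d / 2) * sqrt (real n) / \<epsilon>\<^sup>2))"
    by (intro known_structure_lower_bound) auto
qed auto

end
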